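(* Let $P\subset\mathbb{R}^n$ be a special polytope, i.e. an $n$-dimensional integral convex polytope which is reflexive, weakly symmetric and has regular boundary. Then $P$ is asymptotically Chow polystable.
   Context: An integral convex polytope $P\subset\mathbb{R}^n$ is the convex hull of finitely many points of $\mathbb{Z}^n$; it is assumed $n$-dimensional. For $k\in\mathbb{N}$ (positive integers), $\chi(kP)=\#(kP\cap\mathbb{Z}^n)$, and $\mathrm{Vol}$, $dV$ denote Lebesgue measure. Reflexive: $0$ lies in the interior of $P$ and every facet of $P$ lies on a hyperplane $\sum_{i=1}^n a_i x_i=\pm1$ with all $a_i\in\mathbb{Z}$. Weakly symmetric: for every $k\in\mathbb{N}$ and every affine function $a(x)=a_0+a_1x_1+\cdots+a_nx_n$, the Futaki--Ono invariant $$FO_P(a,k)=\frac{1}{\chi(kP)}\sum_{p:\ kp\in kP\cap\mathbb{Z}^n}a(p)-\frac{1}{\mathrm{Vol}(P)}\int_P a\,dV$$ vanishes. Regular boundary: let $T_{n-1}=\mathrm{conv}\{0,e_1,\dots,e_{n-1}\}\subset\mathbb{R}^n$ be the standard $(n-1)$-simplex. Two subsets of $\mathbb{R}^n$ are integrally isomorphic if one is obtained from the other by a map $x\mapsto Ax+v$ with $A\in SL(n,\mathbb{Z})$, $v\in\mathbb{Z}^n$. $P$ has regular boundary if for every $k\in\mathbb{N}$ there is a triangulation of $\partial(kP)$ (distinct simplices meet only along their boundaries) which restricts to a triangulation of each facet of $kP$, all of whose maximal simplices are integrally isomorphic to $T_{n-1}$, and such that every point $p\in\partial(kP)$ is contained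 in at most $n!$ of the maximal simplices. Chow stability: let $G$ be the largest (finite) subgroup of $SL(n,\mathbb{Z})$ preserving $P$. $P$ (or the polarized toric variety $X_P$) is asymptotically Chow semistable if there is a constant $C$ such that for all integers $k\ge C$ and all $G$-invariant convex functions $f:kP\to\mathbb{R}$, $$\frac{1}{\mathrm{Vol}(kP)}\int_{kP}f\,dV\le\frac{1}{\chi(kP)}\sum_{p\in kP\cap\mathbb{Z}^n}f(p).$$ It is asymptotically Chow polystable if in addition, for all $k\ge C$, equality holds only when $f$ is affine. *)

theory Defs
  imports "HOL-Analysis.Analysis"
begin

definition lattice :: "(real^'n) set" where
  "lattice = {x. \<forall>i. x $ i \<in> \<int>}"

definition integral_polytope :: "(real^'n) set \<Rightarrow> bool" where
  "integral_polytope P \<longleftrightarrow> (\<exists>V. finite V \<and> V \<subseteq> lattice \<and> P = convex hull V)"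

definition dilate :: "nat \<Rightarrow> (real^'n) set \<Rightarrow> (real^'n) set" where
  "dilate k P = (\<lambda>x. real k *\<^sub>R x) ` P"

definition chi :: "(real^'n) set \<Rightarrow> nat" where
  "chi Q = card (Q \<inter> lattice)"

definition affine_fn :: "real \<Rightarrow> real^'n \<Rightarrow> real^'n \<Rightarrow> real" where
  "affine_fn c b x = c + (\<Sum>i\<in>UNIV. b $ i * x $ i)"

definition reflexive_polytope :: "(real^'n) set \<Rightarrow> bool" where
  "reflexive_polytope P \<longleftrightarrow>
     0 \<in> interior P \<and>
     (\<forall>F. F facet_of P \<longrightarrow>
        (\<exists>a\<in>lattice. F \<subseteq> {x. (\<Sum>i\<in>UNIV. a $ i * x $ i) = 1} \<or>
                     F \<subseteq> {x. (\<Sum>i\<in>UNIV. a $ i * x $ i) = -1}))"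

definition volume_mean :: "(real^'n) set \<Rightarrow> (real^'n \<Rightarrow> real) \<Rightarrow> real" where
  "volume_mean Q f = 1 / measure lebesgue Q * (LINT x:Q|lebesgue. f x)"

definition futaki_ono :: "(real^'n) set \<Rightarrow> (real^'n \<Rightarrow> real) \<Rightarrow> nat \<Rightarrow> real" where
  "futaki_ono P a k =
     1 / real (chi (dilate k P)) *
       (\<Sum>p | real k *\<^sub>R p \<in> dilate k P \<inter> lattice. a p)
     - volume_mean P a"

definition weakly_symmetric :: "(real^'n) set \<Rightarrow> bool" where
  "weakly_symmetric P \<longleftrightarrow> (\<forall>k>0. \<forall>c b. futaki_ono P (affine_fn c b) k = 0)"

definition SL_int :: "(real^'n^'n) set" where
  "SL_int = {A. (\<forall>i j. A $ i $ j \<in> \<int>) \<and> det A = 1}"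

definition integrally_isomorphic :: "(real^'n) set \<Rightarrow> (real^'n) set \<Rightarrow> bool" where
  "integrally_isomorphic S T \<longleftrightarrow>
     (\<exists>A\<in>SL_int. \<exists>v\<in>lattice. T = (\<lambda>x. A *v x + v) ` S)"

text \<open>The standard (n-1)-simplex in n-space. The index type carries no order, so the omitted
  basis vector is a parameter. Its choice does not matter up to integral isomorphism: for distinct
  i and j the map sending e_i to e_j, e_j to - e_i and fixing the other basis vectors has
  determinant 1 and carries the simplex omitting e_j to the one omitting e_i.\<close>

definition std_simplex :: "'n \<Rightarrow> (real^'n) set" where
  "std_simplex j = convex hull (insert 0 {axis i 1 | i. i \<noteq> j})"

text \<open>A triangulation is given by its set of maximal simplices. Distinct ones are required to meet
  only along their (relative) boundaries. This is implied by, but does not demand, that they meet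
  in a common face as in \<^const>\<open>triangulation\<close>.\<close>

definition triangulates :: "(real^'n) set set \<Rightarrow> (real^'n) set \<Rightarrow> bool" where
  "triangulates \<T> X \<longleftrightarrow>
     finite \<T> \<and>
     (\<forall>T\<in>\<T>. (int CARD('n) - 1) simplex T) \<and>
     (\<forall>S\<in>\<T>. \<forall>T\<in>\<T>. S \<noteq> T \<longrightarrow> S \<inter> T \<subseteq> rel_frontier S \<inter> rel_frontier T) \<and>
     \<Union>\<T> = X"

definition regular_boundary :: "(real^'n) set \<Rightarrow> bool" where
  "regular_boundary P \<longleftrightarrow>
     (\<forall>k>0. \<exists>\<T>.
        triangulates \<T> (frontier (dilate k P)) \<and>
        (\<forall>F. F facet_of dilate k P \<longrightarrow> triangulates {T \<in> \<T>. T \<subseteq> F} F) \<and>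
        (\<forall>T\<in>\<T>. \<exists>j. integrally_isomorphic (std_simplex j) T) \<and>
        (\<forall>p\<in>frontier (dilate k P). card {T \<in> \<T>. p \<in> T} \<le> fact CARD('n)))"

definition special_polytope :: "(real^'n) set \<Rightarrow> bool" where
  "special_polytope P \<longleftrightarrow>
     integral_polytope P \<and> aff_dim P = int CARD('n) \<and>
     reflexive_polytope P \<and> weakly_symmetric P \<and> regular_boundary P"

text \<open>The full stabilizer of P in SL(n,Z) is the largest subgroup preserving P. It is finite
  for a full-dimensional polytope, since its elements permute the vertices, which span.\<close>

definition sym_group :: "(real^'n) set \<Rightarrow> (real^'n^'n) set" where
  "sym_group P = {A \<in> SL_int. (\<lambda>x. A *v x) ` P = P}"

definition invariant_on :: "(real^'n^'n) set \<Rightarrow> (real^'n) set \<Rightarrow> (real^'n \<Rightarrow> real) \<Rightarrow> bool" where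
  "invariant_on G Q f \<longleftrightarrow> (\<forall>A\<in>G. \<forall>x\<in>Q. f (A *v x) = f x)"

definition lattice_mean :: "(real^'n) set \<Rightarrow> (real^'n \<Rightarrow> real) \<Rightarrow> real" where
  "lattice_mean Q f = 1 / real (chi Q) * (\<Sum>p \<in> Q \<inter> lattice. f p)"

definition chow_semistable_from :: "nat \<Rightarrow> (real^'n) set \<Rightarrow> bool" where
  "chow_semistable_from C P \<longleftrightarrow>
     (\<forall>k\<ge>C. \<forall>f. convex_on (dilate k P) f \<and> invariant_on (sym_group P) (dilate k P) f \<longrightarrow>
        volume_mean (dilate k P) f \<le> lattice_mean (dilate k P) f)"

definition asymptotically_chow_semistable :: "(real^'n) set \<Rightarrow> bool" where
  "asymptotically_chow_semistable P \<longleftrightarrow> (\<exists>C>0. chow_semistable_from C P)"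

definition asymptotically_chow_polystable :: "(real^'n) set \<Rightarrow> bool" where
  "asymptotically_chow_polystable P \<longleftrightarrow>
     (\<exists>C>0. chow_semistable_from C P \<and>
        (\<forall>k\<ge>C. \<forall>f. convex_on (dilate k P) f \<and> invariant_on (sym_group P) (dilate k P) f \<and>
           volume_mean (dilate k P) f = lattice_mean (dilate k P) f \<longrightarrow>
             (\<exists>c b. \<forall>x\<in>dilate k P. f x = affine_fn c b x)))"

end

theory Submission
  imports Defs
begin

text \<open>
  Subtract from the convex function \<open>f\<close> an affine function supporting it at the origin. Weak symmetry
  says that both averages of an affine function agree, so the comparison is unaffected, and one may
  assume \<open>f \<ge> 0 = f 0\<close>. Write \<open>n\<close> for the dimension and \<open>S\<^sub>j\<close> for the sum of \<open>f\<close> over the lattice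
  points of the boundary of \<open>jP\<close>; the lattice sum of \<open>f\<close> over \<open>kP\<close> is at least
  \<open>S\<^sub>1 + \<dots> + S\<^sub>k\<close>.

  Triangulate the boundary of \<open>jP\<close> by unimodular simplices. On each of them convexity bounds \<open>f\<close> by the
  linear interpolation of its values at the \<open>n\<close> vertices, whose mean is the average of those values.
  A vertex lies in at most \<open>n!\<close> simplices, and this is exactly what is needed for the integral of \<open>f\<close>
  over the boundary of \<open>jP\<close>, with respect to the measure that makes a unimodular simplex have volume
  \<open>1 / (n - 1)!\<close>, to be at most \<open>S\<^sub>j\<close>. Along a ray, \<open>t\<^sup>n\<^sup>-\<^sup>1 f (t y)\<close> is a convex function of \<open>t\<close>, so the
  trapezoidal rule overestimates its integral; integrating over all rays gives
  \<open>\<integral> f \<le> S\<^sub>1 + \<dots> + S\<^sub>k - S\<^sub>k / 2\<close> over \<open>kP\<close>. Since \<open>f\<close> also lies below the cone with apex \<open>0\<close>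
  over its values on the boundary of \<open>kP\<close>, the same interpolation gives \<open>\<integral> f \<le> k / (n + 1) S\<^sub>k\<close>.

  Hence the lattice sum exceeds the integral by \<open>S\<^sub>k / 2\<close>. What may be lost is in the normalizing
  factors: the number of lattice points of \<open>kP\<close> is \<open>k\<^sup>n Vol(P) (1 + n / (2 k) + O(1 / k\<^sup>2))\<close>. The
  loss is about \<open>n / (2 k)\<close> times the integral, so about \<open>n / (n + 1)\<close> times \<open>S\<^sub>k / 2\<close> at most, which
  is less than the gain once \<open>k\<close> is large. Equality therefore forces \<open>S\<^sub>k = 0\<close>; then \<open>f\<close> vanishes at
  all lattice points of the boundary, hence everywhere, and the original function was affine.

  The lattice point count needs its second coefficient. Cones over the simplices of a unimodular
  triangulation of the boundary of \<open>P\<close> cover space. Moving a lattice point slightly in a generic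
  direction \<open>\<xi>\<close> selects a cone for it, in which those coordinates have to be strictly positive where
  \<open>\<xi>\<close> has a negative coordinate. The points of a cone selected in this way are counted by a binomial
  coefficient, and averaging the counts for \<open>\<xi>\<close> and \<open>- \<xi>\<close> makes the second coefficient independent of
  the cone.

  Reflexivity enters through one computation: a simplex of the triangulated boundary of \<open>kP\<close> lies at
  lattice height \<open>k\<close> above the origin, so the matrix whose columns are its vertices has determinant
  \<open>\<plusminus> k\<close> (\<open>exists_boundary_cones\<close>). The other pillars are \<open>eventually_chi_dilate_less\<close> for the
  lattice point count, \<open>integral_le_trapezoid\<close> and \<open>integral_le_last_shell\<close> for the two integral
  bounds, and \<open>normalized_chow_inequality\<close>, which combines them.
\<close>

section \<open>Linear change of variables for Lebesgue measure\<close>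

lemma det_shear:
  fixes m n :: "'n::finite"
  assumes "m \<noteq> n"
  shows "det (matrix (\<lambda>x::real^'n. \<chi> i. if i = m then x $ m + x $ n else x $ i)) = 1"
proof -
  have "matrix (\<lambda>x::real^'n. \<chi> i. if i = m then x $ m + x $ n else x $ i)
      = (\<chi> k. if k = m then row m (mat 1) + 1 *s row n (mat 1) else row k (mat 1))"
    by (auto simp: matrix_def vec_eq_iff row_def mat_def axis_def)
  then show ?thesis
    using det_row_operation[OF assms, where c=1 and A="mat 1 :: real^'n^'n"] by simp
qed

text \<open>Together with coordinate swaps and diagonal matrices, shears generate all invertible matrices; this
  gives the change of variables formula for an index type that carries no order.\<close>

lemma nn_integral_shear:
  fixes m n :: "'n::finite" and F :: "real^'n \<Rightarrow> ennreal"
  assumes "m \<noteq> n" and [measurable]: "F \<in> borel_measurable borel"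
  shows "(\<integral>\<^sup>+x. F (\<chi> i. if i = m then x $ m + x $ n else x $ i) \<partial>lborel) = (\<integral>\<^sup>+x. F x \<partial>lborel)"
proof -
  define h where "h = (\<lambda>x::real^'n. \<chi> i. if i = m then x $ m + x $ n else x $ i)"
  define g where "g = (\<lambda>x::real^'n. \<chi> i. if i = m then x $ m - x $ n else x $ i)"
  have hg: "h (g x) = x" and gh: "g (h x) = x" for x
    using assms(1) by (auto simp: h_def g_def vec_eq_iff)
  have lin: "linear h" "linear g"
    unfolding h_def g_def by (rule linearI; auto simp: algebra_simps vec_eq_iff)+
  have [measurable]: "h \<in> borel_measurable borel" "g \<in> borel_measurable borel"
    using lin by (auto intro!: borel_measurable_continuous_onI linear_continuous_on simp: linear_linear)
  have vol_cbox: "measure lebesgue (h ` cbox a b) = 1 * measure lebesgue (cbox a b)" for a b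
  proof (cases "cbox a b = {}")
    case False
    \<comment> \<open>The library lemma wants the \<open>n\<close>-th coordinate to be nonnegative, so translate the box first.\<close>
    define v where "v = axis n (- a $ n)"
    have ne: "cbox (v + a) (v + b) \<noteq> {}"
      using False by (metis cbox_translation image_is_empty)
    have eq: "h ` cbox (v + a) (v + b) = (+) (h v) ` (h ` cbox a b)"
      by (simp add: cbox_translation image_image linear_add[OF lin(1)])
    have "measure lebesgue (h ` cbox (v + a) (v + b)) = measure lebesgue (cbox (v + a) (v + b))"
      unfolding h_def by (rule measure_shear_interval[OF assms(1) ne]) (simp add: v_def)
    then show ?thesis
      unfolding eq by (simp only: cbox_translation measure_translation mult_1)
  qed simp
  have "lborel = distr lborel borel g"
  proof (rule lborel_eqI)
    fix l u :: "real^'n" assume le: "\<And>b. b \<in> Basis \<Longrightarrow> l \<bullet> b \<le> u \<bullet> b"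
    have pre: "g -` box l u = h ` box l u"
    proof (intro set_eqI iffI)
      show "x \<in> h ` box l u" if "x \<in> g -` box l u" for x
        using that hg[of x] by (metis imageI vimageE)
      show "x \<in> g -` box l u" if "x \<in> h ` box l u" for x
        using that by (auto simp: gh)
    qed
    have vol: "h ` box l u \<in> lmeasurable" "measure lebesgue (h ` box l u) = measure lebesgue (box l u)"
      using measure_linear_sufficient[OF lin(1) lmeasurable_box vol_cbox, of l u] by auto
    have meas: "h ` box l u \<in> sets borel"
      unfolding pre[symmetric] using measurable_sets[of g borel borel "box l u"] by simp
    have "emeasure (distr lborel borel g) (box l u) = emeasure lborel (h ` box l u)"
      by (subst emeasure_distr) (auto simp: pre)
    also have "\<dots> = emeasure lebesgue (h ` box l u)"
      using meas by simp
    also have "\<dots> = emeasure lebesgue (box l u)"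
      using vol by (metis emeasure_eq_measure2 lmeasurable_box)
    also have "\<dots> = (\<Prod>b\<in>Basis. (u - l) \<bullet> b)"
      using le by (simp add: emeasure_lborel_box)
    finally show "emeasure (distr lborel borel g) (box l u) = (\<Prod>b\<in>Basis. (u - l) \<bullet> b)" .
  qed simp
  then have "(\<integral>\<^sup>+x. F (h x) \<partial>lborel) = (\<integral>\<^sup>+x. F (h x) \<partial>distr lborel borel g)"
    by simp
  also have "\<dots> = (\<integral>\<^sup>+x. F x \<partial>lborel)"
    by (subst nn_integral_distr) (auto simp: hg)
  finally show ?thesis
    by (simp add: h_def)
qed

lemma Basis_cart_eq_range: "(Basis :: (real^'n) set) = range (\<lambda>i. axis i 1)"
  by (auto simp: Basis_vec_def)

lemma prod_Basis_cart: "(\<Prod>b\<in>(Basis :: (real^'n) set). g b) = (\<Prod>i\<in>UNIV. g (axis i 1))"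
  unfolding Basis_cart_eq_range by (subst prod.reindex) (auto simp: inj_on_def axis_eq_axis)

lemma sum_Basis_cart: "(\<Sum>b\<in>(Basis :: (real^'n) set). g b) = (\<Sum>i\<in>UNIV. g (axis i 1))"
  unfolding Basis_cart_eq_range by (subst sum.reindex) (auto simp: inj_on_def axis_eq_axis)

lemma nn_integral_swap_coords:
  fixes m n :: "'n::finite" and F :: "real^'n \<Rightarrow> ennreal"
  assumes [measurable]: "F \<in> borel_measurable borel"
  shows "(\<integral>\<^sup>+x. F (\<chi> i. x $ Transposition.transpose m n i) \<partial>lborel) = (\<integral>\<^sup>+x. F x \<partial>lborel)"
proof -
  define \<tau> where "\<tau> = Transposition.transpose m n"
  have tau_tau: "\<tau> (\<tau> i) = i" for i
    by (simp add: \<tau>_def)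
  define h where "h = (\<lambda>x::real^'n. \<chi> i. x $ \<tau> i)"
  have lin: "linear h"
    unfolding h_def by (rule linearI) (auto simp: vec_eq_iff)
  have [measurable]: "h \<in> borel_measurable borel"
    using lin by (auto intro!: borel_measurable_continuous_onI linear_continuous_on simp: linear_linear)
  have "lborel = distr lborel borel h"
  proof (rule lborel_eqI)
    fix l u :: "real^'n" assume le: "\<And>b. b \<in> Basis \<Longrightarrow> l \<bullet> b \<le> u \<bullet> b"
    then have le': "l $ i \<le> u $ i" for i
      using le[of "axis i 1"] by (simp add: cart_eq_inner_axis)
    have pre: "h -` box l u = box (h l) (h u)"
    proof (intro set_eqI)
      fix x
      have "(\<forall>i. l $ i < x $ \<tau> i \<and> x $ \<tau> i < u $ i) \<longleftrightarrow> (\<forall>i. l $ \<tau> i < x $ i \<and> x $ i < u $ \<tau> i)"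
        using tau_tau by metis
      then show "x \<in> h -` box l u \<longleftrightarrow> x \<in> box (h l) (h u)"
        by (simp add: h_def mem_box_cart)
    qed
    have "emeasure (distr lborel borel h) (box l u) = emeasure lborel (box (h l) (h u))"
      by (subst emeasure_distr) (auto simp: pre)
    also have "\<dots> = (\<Prod>b\<in>Basis. (h u - h l) \<bullet> b)"
      using le' by (subst emeasure_lborel_box) (auto simp: h_def Basis_cart_eq_range inner_axis)
    also have "(\<Prod>b\<in>Basis. (h u - h l) \<bullet> b) = (\<Prod>i\<in>UNIV. (u - l) $ \<tau> i)"
      by (simp add: prod_Basis_cart inner_axis h_def)
    also have "\<dots> = (\<Prod>i\<in>UNIV. (u - l) $ i)"
      using prod.permute[OF permutes_swap_id[of m UNIV n], of "\<lambda>i. (u - l) $ i"]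
      by (simp add: o_def \<tau>_def)
    also have "\<dots> = (\<Prod>b\<in>Basis. (u - l) \<bullet> b)"
      by (simp add: prod_Basis_cart inner_axis)
    finally show "emeasure (distr lborel borel h) (box l u) = (\<Prod>b\<in>Basis. (u - l) \<bullet> b)" .
  qed simp
  then have "(\<integral>\<^sup>+x. F x \<partial>lborel) = (\<integral>\<^sup>+x. F x \<partial>distr lborel borel h)"
    by simp
  also have "\<dots> = (\<integral>\<^sup>+x. F (h x) \<partial>lborel)"
    by (rule nn_integral_distr) auto
  finally show ?thesis
    by (simp add: h_def \<tau>_def)
qed

lemma nn_integral_stretch:
  fixes c :: "'n::finite \<Rightarrow> real" and F :: "real^'n \<Rightarrow> ennreal"
  assumes c: "\<And>i. c i \<noteq> 0" and [measurable]: "F \<in> borel_measurable borel"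
  shows "(\<integral>\<^sup>+x. F x \<partial>lborel) = ennreal \<bar>prod c UNIV\<bar> * (\<integral>\<^sup>+x. F (\<chi> i. c i * x $ i) \<partial>lborel)"
proof -
  define d where "d = (\<lambda>b::real^'n. (\<chi> i. c i) \<bullet> b)"
  have d: "d (axis i 1) = c i" for i
    by (simp add: d_def inner_axis)
  have T: "(\<Sum>j\<in>Basis. (d j * (x \<bullet> j)) *\<^sub>R j) = (\<chi> i. c i * x $ i)" for x
  proof -
    have "(\<Sum>j\<in>Basis. (d j * (x \<bullet> j)) *\<^sub>R j) = (\<Sum>i\<in>UNIV. (c i * x $ i) *\<^sub>R axis i 1)"
      by (simp add: sum_Basis_cart inner_axis d)
    also have "\<dots> = (\<chi> i. c i * x $ i)"
      by (simp add: vec_eq_iff axis_def if_distrib cong: if_cong)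
    finally show ?thesis .
  qed
  have "lborel = density (distr lborel borel (\<lambda>x. 0 + (\<Sum>j\<in>Basis. (d j * (x \<bullet> j)) *\<^sub>R j))) (\<lambda>_. (\<Prod>j\<in>Basis. \<bar>d j\<bar>))"
    by (rule lborel_affine_euclidean) (auto simp: Basis_cart_eq_range d c)
  also have "(\<Prod>j\<in>Basis. \<bar>d j\<bar>) = \<bar>prod c UNIV\<bar>"
    by (simp add: prod_Basis_cart d abs_prod)
  finally have eq: "lborel = density (distr lborel borel (\<lambda>x::real^'n. \<chi> i. c i * x $ i)) (\<lambda>_. ennreal \<bar>prod c UNIV\<bar>)"
    unfolding T by simp
  have lin: "linear (\<lambda>x::real^'n. \<chi> i. c i * x $ i)"
    by (rule linearI) (auto simp: vec_eq_iff algebra_simps)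
  have [measurable]: "(\<lambda>x::real^'n. \<chi> i. c i * x $ i) \<in> borel_measurable borel"
    using lin by (auto intro!: borel_measurable_continuous_onI linear_continuous_on simp: linear_linear)
  show ?thesis
    by (subst eq) (simp add: nn_integral_density nn_integral_distr nn_integral_cmult)
qed

text \<open>By induction over a factorization into elementary matrices. Factors with a zero row are excluded by
  the determinant.\<close>

theorem nn_integral_linear_change:
  fixes A :: "real^'n^'n" and F :: "real^'n \<Rightarrow> ennreal"
  assumes "det A \<noteq> 0" and "F \<in> borel_measurable borel"
  shows "(\<integral>\<^sup>+x. F x \<partial>lborel) = ennreal \<bar>det A\<bar> * (\<integral>\<^sup>+x. F (A *v x) \<partial>lborel)"
proof -
  define P where "P = (\<lambda>h::real^'n \<Rightarrow> real^'n. linear h \<longrightarrow> det (matrix h) \<noteq> 0 \<longrightarrow>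
      (\<forall>F\<in>borel_measurable borel. (\<integral>\<^sup>+x. F x \<partial>lborel) = ennreal \<bar>det (matrix h)\<bar> * (\<integral>\<^sup>+x. F (h x) \<partial>lborel)))"
  have "P ((*v) A)"
  proof (rule induct_linear_elementary[of "(*v) A"])
    show "linear ((*v) A)" by simp
  next
    fix f g :: "real^'n \<Rightarrow> real^'n"
    assume lin: "linear f" "linear g" and P: "P f" "P g"
    show "P (f \<circ> g)"
      unfolding P_def
    proof (intro impI ballI)
      fix F :: "real^'n \<Rightarrow> ennreal" assume [measurable]: "F \<in> borel_measurable borel"
      assume "det (matrix (f \<circ> g)) \<noteq> 0"
      then have dets: "det (matrix f) \<noteq> 0" "det (matrix g) \<noteq> 0"
        by (auto simp: matrix_compose[OF lin(2,1)] det_mul)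
      have [measurable]: "f \<in> borel_measurable borel"
        using lin by (auto intro!: borel_measurable_continuous_onI linear_continuous_on simp: linear_linear)
      have "(\<integral>\<^sup>+x. F x \<partial>lborel) = ennreal \<bar>det (matrix f)\<bar> * (\<integral>\<^sup>+x. F (f x) \<partial>lborel)"
        using P(1) lin(1) dets(1) \<open>F \<in> borel_measurable borel\<close> unfolding P_def by blast
      also have "(\<integral>\<^sup>+x. F (f x) \<partial>lborel) = ennreal \<bar>det (matrix g)\<bar> * (\<integral>\<^sup>+x. F (f (g x)) \<partial>lborel)"
        using P(2)[unfolded P_def, rule_format, of "\<lambda>x. F (f x)"] lin(2) dets(2) by measurable
      finally show "(\<integral>\<^sup>+x. F x \<partial>lborel) = ennreal \<bar>det (matrix (f \<circ> g))\<bar> * (\<integral>\<^sup>+x. F ((f \<circ> g) x) \<partial>lborel)"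
        by (simp add: matrix_compose[OF lin(2,1)] det_mul abs_mult ennreal_mult mult.assoc)
    qed
  next
    fix f :: "real^'n \<Rightarrow> real^'n" and i
    assume "linear f" and "\<And>x. f x $ i = 0"
    then have "det (matrix f) = 0"
      by (intro det_zero_row(2)[of i]) (auto simp: matrix_def row_def vec_eq_iff)
    then show "P f"
      by (simp add: P_def)
  next
    fix c :: "'n \<Rightarrow> real"
    have det: "det (matrix (\<lambda>x::real^'n. \<chi> i. c i * x $ i)) = prod c UNIV"
      by (simp add: axis_def matrix_def det_diagonal)
    show "P (\<lambda>x. \<chi> i. c i * x $ i)"
      unfolding P_def det by (intro impI ballI nn_integral_stretch) auto
  next
    fix m n :: 'n assume "m \<noteq> n"
    let ?h = "\<lambda>v::(real, 'n) vec. \<chi> i. v $ Transposition.transpose m n i"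
    have "linear ?h"
      by (rule linearI) (auto simp: vec_eq_iff)
    moreover have "?h \<circ> ?h = id"
      by (simp add: fun_eq_iff vec_eq_iff)
    ultimately have "matrix ?h ** matrix ?h = matrix (id :: real^'n \<Rightarrow> real^'n)"
      using matrix_compose[of ?h ?h] by simp
    then have "det (matrix ?h ** matrix ?h) = 1"
      by (simp add: matrix_id)
    then have "det (matrix ?h) * det (matrix ?h) = 1"
      by (simp only: det_mul)
    then have "\<bar>det (matrix ?h)\<bar> = 1"
      unfolding square_eq_1_iff by auto
    then show "P ?h"
      unfolding P_def using nn_integral_swap_coords[where m=m and n=n] by fastforce
  next
    fix m n :: 'n assume "m \<noteq> n"
    then show "P (\<lambda>x. \<chi> i. if i = m then x $ m + x $ n else x $ i)"
      unfolding P_def det_shear[OF \<open>m \<noteq> n\<close>] using nn_integral_shear[OF \<open>m \<noteq> n\<close>] by fastforce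
  qed
  then show ?thesis
    unfolding P_def using assms by (metis matrix_of_matrix_vector_mul matrix_vector_mul_linear)
qed

section \<open>Integrating linear functions over simplicial cones\<close>

definition orthant :: "(real^'n) set" where
  "orthant = {x. \<forall>i. 0 \<le> x $ i}"

definition coord_sum :: "real^'n \<Rightarrow> real" where
  "coord_sum x = (\<Sum>i\<in>UNIV. x $ i)"

lemma coord_sum_add: "coord_sum (x + y) = coord_sum x + coord_sum y"
  and coord_sum_scaleR: "coord_sum (c *\<^sub>R x) = c * coord_sum x"
  and coord_sum_axis [simp]: "coord_sum (axis i c) = c"
  by (simp_all add: coord_sum_def sum.distrib sum_distrib_left axis_def)

lemma coord_sum_nonneg: "x \<in> orthant \<Longrightarrow> 0 \<le> coord_sum x"
  by (simp add: coord_sum_def orthant_def sum_nonneg)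

lemma borel_measurable_coord_sum [measurable]: "coord_sum \<in> borel_measurable borel"
  unfolding coord_sum_def by measurable

lemma borel_measurable_vec_nth [measurable (raw)]:
  fixes f :: "'a \<Rightarrow> real^'n"
  assumes "f \<in> borel_measurable M"
  shows "(\<lambda>x. f x $ i) \<in> borel_measurable M"
  using borel_measurable_inner[OF assms borel_measurable_const[of "axis i 1"]]
  by (simp add: cart_eq_inner_axis)

lemma sets_borel_orthant [measurable]: "orthant \<in> sets borel"
proof -
  have "orthant = (\<Inter>i. {x::real^'n. 0 \<le> x $ i})"
    by (auto simp: orthant_def)
  also have "closed \<dots>"
    by (intro closed_INT ballI closed_Collect_le continuous_intros)
  finally show ?thesis
    by (rule borel_closed)
qed

lemma emeasure_corner_simplex:
  assumes "0 \<le> s"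
  shows "emeasure lborel {x \<in> orthant. coord_sum (x::real^'n) \<le> s} = ennreal (s ^ CARD('n) / fact CARD('n))"
proof -
  let ?B = "Basis :: (real^'n) set"
  have eq: "{x \<in> orthant. coord_sum (x::real^'n) \<le> s} = {x. (\<forall>i\<in>?B. 0 \<le> x \<bullet> i) \<and> sum ((\<bullet>) x) ?B \<le> s}"
  proof -
    have "sum ((\<bullet>) x) ?B = coord_sum x" for x
      by (simp add: sum_Basis_cart coord_sum_def inner_axis)
    then show ?thesis
      by (simp add: orthant_def Basis_cart_eq_range inner_axis)
  qed
  have meas: "{x \<in> orthant. coord_sum (x::real^'n) \<le> s} \<in> sets borel"
    by measurable
  have "emeasure lborel {x \<in> orthant. coord_sum (x::real^'n) \<le> s}
      = emeasure (distr (Pi\<^sub>M ?B (\<lambda>b. lborel)) borel (\<lambda>f. \<Sum>b\<in>?B. f b *\<^sub>R b))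
          {x. (\<forall>i\<in>?B. 0 \<le> x \<bullet> i) \<and> sum ((\<bullet>) x) ?B \<le> s}"
    unfolding eq by (subst lborel_eq) simp
  also have "\<dots> = emeasure (Pi\<^sub>M ?B (\<lambda>b. lborel))
      ({y. (\<forall>i\<in>?B. 0 \<le> y i) \<and> sum y ?B \<le> s} \<inter> space (Pi\<^sub>M ?B (\<lambda>b. lborel)))"
    using meas unfolding eq by (subst emeasure_distr) auto
  also have "\<dots> = ennreal (s ^ CARD('n) / fact CARD('n))"
    using assms by (subst emeasure_std_simplex_aux) (auto simp: divide_ennreal)
  finally show ?thesis .
qed

text \<open>The points of a corner simplex of size \<open>s\<close> whose \<open>j\<close>-th coordinate is at least \<open>r\<close> form a
  translated corner simplex of size \<open>s - r\<close>.\<close>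

lemma emeasure_corner_simplex_slice:
  assumes "0 \<le> r"
  shows "emeasure lborel {x \<in> orthant. coord_sum (x::real^'n) \<le> s \<and> r \<le> x $ j}
    = ennreal ((s - r) ^ CARD('n) / fact CARD('n)) * indicator {..s} r"
proof (cases "r \<le> s")
  case True
  have pre: "(+) (axis j r) -` {x \<in> orthant. coord_sum (x::real^'n) \<le> s \<and> r \<le> x $ j}
      = {x \<in> orthant. coord_sum x \<le> s - r}"
  proof -
    have "(\<forall>i. 0 \<le> axis j r $ i + x $ i) \<and> 0 \<le> x $ j \<longleftrightarrow> (\<forall>i. 0 \<le> x $ i)" for x :: "real^'n"
      using assms by (auto simp: axis_def)
    moreover have "axis j r $ j = r"
      by simp
    ultimately show ?thesis
      by (auto simp: coord_sum_add orthant_def)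
  qed
  have meas: "{x \<in> orthant. coord_sum (x::real^'n) \<le> s \<and> r \<le> x $ j} \<in> sets borel"
    by measurable
  have "emeasure lborel {x \<in> orthant. coord_sum (x::real^'n) \<le> s \<and> r \<le> x $ j}
      = emeasure (distr lborel borel ((+) (axis j r))) {x \<in> orthant. coord_sum (x::real^'n) \<le> s \<and> r \<le> x $ j}"
    by (simp add: lborel_distr_plus)
  also have "\<dots> = emeasure lborel
      ((+) (axis j r) -` {x \<in> orthant. coord_sum (x::real^'n) \<le> s \<and> r \<le> x $ j} \<inter> space lborel)"
    by (rule emeasure_distr) (use meas in auto)
  also have "\<dots> = emeasure lborel {x \<in> orthant. coord_sum (x::real^'n) \<le> s - r}"
    unfolding pre by simp
  finally show ?thesis
    using True by (simp add: emeasure_corner_simplex)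
next
  case False
  have "x $ j \<le> coord_sum x" if "x \<in> orthant" for x :: "real^'n"
    using that unfolding coord_sum_def orthant_def by (intro member_le_sum) auto
  then have eq: "{x \<in> orthant. coord_sum (x::real^'n) \<le> s \<and> r \<le> x $ j} = {}"
    using False by fastforce
  show ?thesis
    unfolding eq using False by simp
qed

lemma DERIV_power_over_fact:
  "((\<lambda>r. r ^ Suc n / fact (Suc n)) has_real_derivative r ^ n / fact n) (at r)"
proof -
  have "((\<lambda>r. r ^ Suc n / fact (Suc n)) has_real_derivative (real (Suc n) * r ^ n) / fact (Suc n)) (at r)"
    using DERIV_pow[of "Suc n" r] by (intro DERIV_cdivide) simp
  moreover have "(real (Suc n) * r ^ n) / fact (Suc n) = r ^ n / fact n"
    by (simp add: divide_simps del: of_nat_Suc)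
  ultimately show ?thesis
    by simp
qed

text \<open>Writing the coordinate as the length of \<open>[0, x\<^sub>j]\<close> and exchanging integrals reduces the moment to
  the volumes of the slices above.\<close>

lemma nn_integral_coordinate_corner_simplex:
  assumes "0 \<le> s"
  shows "(\<integral>\<^sup>+x. ennreal (x $ j) * indicator {x \<in> orthant. coord_sum (x::real^'n) \<le> s} x \<partial>lborel)
    = ennreal (s ^ Suc CARD('n) / fact (Suc CARD('n)))"
proof -
  let ?n = "CARD('n)"
  let ?D = "\<lambda>r. {x \<in> orthant. coord_sum (x::real^'n) \<le> s \<and> r \<le> x $ j}"
  let ?G = "\<lambda>r x. indicator {0..} r * (indicator orthant x * (if coord_sum x \<le> s \<and> r \<le> x $ j then 1 else 0)) :: ennreal"
  have "(\<integral>\<^sup>+x. ennreal (x $ j) * indicator {x \<in> orthant. coord_sum (x::real^'n) \<le> s} x \<partial>lborel)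
      = (\<integral>\<^sup>+x. (\<integral>\<^sup>+r. ?G r x \<partial>lborel) \<partial>lborel)"
  proof (intro nn_integral_cong)
    fix x :: "real^'n"
    show "ennreal (x $ j) * indicator {x \<in> orthant. coord_sum (x::real^'n) \<le> s} x
        = (\<integral>\<^sup>+r. ?G r x \<partial>lborel)"
    proof (cases "x \<in> orthant \<and> coord_sum x \<le> s")
      case True
      then have "(\<integral>\<^sup>+r. ?G r x \<partial>lborel) = (\<integral>\<^sup>+r. indicator {0..x $ j} r \<partial>lborel)"
        by (intro nn_integral_cong) (auto simp: indicator_def)
      with True show ?thesis
        by (simp add: orthant_def)
    next
      case False
      then have "(\<integral>\<^sup>+r. ?G r x \<partial>lborel) = (\<integral>\<^sup>+(r::real). 0 \<partial>lborel)"
        by (intro nn_integral_cong) (auto simp: indicator_def)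
      with False show ?thesis
        by simp
    qed
  qed
  also have "\<dots> = (\<integral>\<^sup>+r. (\<integral>\<^sup>+x. ?G r x \<partial>lborel) \<partial>lborel)"
    by (rule lborel_pair.Fubini') measurable
  also have "\<dots> = (\<integral>\<^sup>+r. ennreal ((s - r) ^ ?n / fact ?n) * indicator {0..s} r \<partial>lborel)"
  proof (intro nn_integral_cong)
    fix r :: real
    have "(\<integral>\<^sup>+x. ?G r x \<partial>lborel) = (\<integral>\<^sup>+x. indicator {0..} r * indicator (?D r) x \<partial>lborel)"
      by (intro nn_integral_cong) (auto simp: indicator_def)
    also have "\<dots> = indicator {0..} r * emeasure lborel (?D r)"
      by (subst nn_integral_cmult) auto
    also have "\<dots> = ennreal ((s - r) ^ ?n / fact ?n) * indicator {0..s} r"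
      by (cases "0 \<le> r") (auto simp: emeasure_corner_simplex_slice indicator_def)
    finally show "(\<integral>\<^sup>+x. ?G r x \<partial>lborel)
        = ennreal ((s - r) ^ ?n / fact ?n) * indicator {0..s} r" .
  qed
  also have "\<dots> = ennreal (- ((s - s) ^ Suc ?n / fact (Suc ?n)) - - ((s - 0) ^ Suc ?n / fact (Suc ?n)))"
  proof (rule nn_integral_FTC_Icc)
    fix r :: real
    show "((\<lambda>r. - ((s - r) ^ Suc ?n / fact (Suc ?n))) has_real_derivative (s - r) ^ ?n / fact ?n) (at r)"
    proof -
      have "((\<lambda>r. (s - r) ^ Suc ?n / fact (Suc ?n)) has_real_derivative (s - r) ^ ?n / fact ?n * (0 - 1)) (at r)"
        by (rule DERIV_chain2[OF DERIV_power_over_fact]) (intro derivative_intros)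
      from DERIV_minus[OF this] show ?thesis
        by simp
    qed
  qed (use assms in auto)
  also have "\<dots> = ennreal (s ^ Suc ?n / fact (Suc ?n))"
    by simp
  finally show ?thesis .
qed

text \<open>The moments of the corner simplices are the distribution function of this push-forward, so it has
  an explicit density. This replaces integration in polar coordinates.\<close>

lemma distr_coordinate_density_coord_sum:
  "distr (density lborel (\<lambda>x. ennreal (x $ j) * indicator orthant x)) borel (coord_sum :: real^'n \<Rightarrow> real)
    = density lborel (\<lambda>t. ennreal (t ^ CARD('n) / fact CARD('n)) * indicator {0..} t)" (is "?M = ?N")
proof -
  let ?n = "CARD('n)"
  have M: "emeasure ?M {..s} = ennreal (s ^ Suc ?n / fact (Suc ?n)) * indicator {0..} s" for s
  proof -
    have "emeasure ?M {..s} = (\<integral>\<^sup>+x. ennreal (x $ j) * indicator {x \<in> orthant. coord_sum (x::real^'n) \<le> s} x \<partial>lborel)"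
      by (subst emeasure_distr)
        (auto simp: emeasure_density vimage_def mult.assoc indicator_def intro!: nn_integral_cong)
    also have "\<dots> = ennreal (s ^ Suc ?n / fact (Suc ?n)) * indicator {0..} s"
    proof (cases "0 \<le> s")
      case True
      then show ?thesis
        by (simp add: nn_integral_coordinate_corner_simplex del: fact_Suc power_Suc)
    next
      case False
      then have "{x \<in> orthant. coord_sum (x::real^'n) \<le> s} = {}"
        using coord_sum_nonneg by fastforce
      with False show ?thesis
        by simp
    qed
    finally show ?thesis .
  qed
  have N: "emeasure ?N {..s} = ennreal (s ^ Suc ?n / fact (Suc ?n)) * indicator {0..} s" for s
  proof -
    have "emeasure ?N {..s} = (\<integral>\<^sup>+t. ennreal (t ^ ?n / fact ?n) * indicator {0..s} t \<partial>lborel)"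
      by (auto simp: emeasure_density indicator_def intro!: nn_integral_cong)
    also have "\<dots> = ennreal (s ^ Suc ?n / fact (Suc ?n)) * indicator {0..} s"
    proof (cases "0 \<le> s")
      case True
      have "(\<integral>\<^sup>+t. ennreal (t ^ ?n / fact ?n) * indicator {0..s} t \<partial>lborel)
          = ennreal (s ^ Suc ?n / fact (Suc ?n) - 0 ^ Suc ?n / fact (Suc ?n))"
      proof (rule nn_integral_FTC_Icc)
        fix r :: real
        show "((\<lambda>r. r ^ Suc ?n / fact (Suc ?n)) has_real_derivative r ^ ?n / fact ?n) (at r)"
          by (rule DERIV_power_over_fact)
      qed (use True in auto)
      with True show ?thesis
        by simp
    qed simp
    finally show ?thesis .
  qed
  show ?thesis
  proof (rule measure_eqI_generator_eq)
    show "Int_stable (range (atMost :: real \<Rightarrow> _))"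
      by (auto simp: Int_stable_def)
    show "range (atMost :: real \<Rightarrow> _) \<subseteq> Pow UNIV"
      by simp
    show "sets ?M = sigma_sets UNIV (range atMost)" "sets ?N = sigma_sets UNIV (range atMost)"
      by (simp_all add: borel_eq_atMost)
    show "range (\<lambda>i::nat. {..real i}) \<subseteq> range atMost"
      by auto
    show "(\<Union>i::nat. {..real i}) = UNIV"
      by (auto intro: real_arch_simple)
    show "emeasure ?M {..real i} \<noteq> \<infinity>" for i
      unfolding M by (simp add: ennreal_mult_eq_top_iff)
    show "emeasure ?M X = emeasure ?N X" if "X \<in> range atMost" for X
      using that by (auto simp: M N)
  qed
qed

lemma nn_integral_radial_coordinate:
  assumes [measurable]: "\<phi> \<in> borel_measurable borel"
  shows "(\<integral>\<^sup>+x. ennreal (x $ j) * \<phi> (coord_sum (x::real^'n)) * indicator orthant x \<partial>lborel)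
    = (\<integral>\<^sup>+t. ennreal (t ^ CARD('n) / fact CARD('n)) * \<phi> t * indicator {0..} t \<partial>lborel)"
proof -
  have "(\<integral>\<^sup>+x. ennreal (x $ j) * \<phi> (coord_sum (x::real^'n)) * indicator orthant x \<partial>lborel)
      = integral\<^sup>N (distr (density lborel (\<lambda>x. ennreal (x $ j) * indicator orthant x)) borel (coord_sum :: real^'n \<Rightarrow> real)) \<phi>"
    by (subst nn_integral_distr)
      (auto simp: nn_integral_density ac_simps intro!: nn_integral_cong)
  also have "\<dots> = (\<integral>\<^sup>+t. ennreal (t ^ CARD('n) / fact CARD('n)) * \<phi> t * indicator {0..} t \<partial>lborel)"
    unfolding distr_coordinate_density_coord_sum
    by (subst nn_integral_density) (auto simp: ac_simps intro!: nn_integral_cong)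
  finally show ?thesis .
qed

text \<open>On the cone spanned by the columns of \<open>B\<close>: the linear function with value \<open>c i\<close> on the \<open>i\<close>-th
  column, weighted by \<open>\<phi>\<close> of the height above the apex, where the columns have height \<open>1\<close>. It is \<open>0\<close>
  off the cone.\<close>

definition cone_fun :: "real^'n^'n \<Rightarrow> ('n \<Rightarrow> real) \<Rightarrow> (real \<Rightarrow> real) \<Rightarrow> real^'n \<Rightarrow> real" where
  "cone_fun B c \<phi> x = (let y = matrix_inv B *v x in
     indicator orthant y * \<phi> (coord_sum y) * (\<Sum>i\<in>UNIV. c i * y $ i))"

lemma borel_measurable_cone_fun [measurable]:
  assumes [measurable]: "\<phi> \<in> borel_measurable borel"
  shows "cone_fun B c \<phi> \<in> borel_measurable borel"
proof -
  have [measurable]: "(\<lambda>x. matrix_inv B *v x) \<in> borel_measurable borel"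
    by (intro borel_measurable_continuous_onI linear_continuous_on matrix_vector_mul_bounded_linear)
  show ?thesis
    unfolding cone_fun_def Let_def by measurable
qed

lemma matrix_inv_vector_cancel:
  fixes B :: "real^'n^'n"
  assumes "det B \<noteq> 0"
  shows "matrix_inv B *v (B *v y) = y" and "B *v (matrix_inv B *v y) = y"
proof -
  have "\<exists>C. B ** C = mat 1 \<and> C ** B = mat 1"
    using assms by (simp add: invertible_det_nz[symmetric] invertible_def)
  then have "B ** matrix_inv B = mat 1 \<and> matrix_inv B ** B = mat 1"
    unfolding matrix_inv_def by (rule someI_ex)
  then show "matrix_inv B *v (B *v y) = y" "B *v (matrix_inv B *v y) = y"
    by (simp_all add: matrix_vector_mul_assoc)
qed

lemma cone_fun_matrix_vector_mult:
  assumes "det B \<noteq> 0"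
  shows "cone_fun B c \<phi> (B *v y) = indicator orthant y * \<phi> (coord_sum y) * (\<Sum>i\<in>UNIV. c i * y $ i)"
  by (simp add: cone_fun_def matrix_inv_vector_cancel[OF assms])

lemma nn_integral_cone_fun:
  fixes B :: "real^'n^'n"
  assumes det: "det B \<noteq> 0" and c: "\<And>i. 0 \<le> c i" and \<phi>: "\<And>t. 0 \<le> \<phi> t"
    and [measurable]: "\<phi> \<in> borel_measurable borel"
  shows "(\<integral>\<^sup>+x. ennreal (cone_fun B c \<phi> x) \<partial>lborel)
    = ennreal (\<bar>det B\<bar> * (\<Sum>i\<in>UNIV. c i))
      * (\<integral>\<^sup>+t. ennreal (t ^ CARD('n) / fact CARD('n)) * ennreal (\<phi> t) * indicator {0..} t \<partial>lborel)"
proof -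
  let ?I = "\<integral>\<^sup>+t. ennreal (t ^ CARD('n) / fact CARD('n)) * ennreal (\<phi> t) * indicator {0..} t \<partial>lborel"
  have "(\<integral>\<^sup>+x. ennreal (cone_fun B c \<phi> x) \<partial>lborel)
      = ennreal \<bar>det B\<bar> * (\<integral>\<^sup>+y. ennreal (cone_fun B c \<phi> (B *v y)) \<partial>lborel)"
    by (rule nn_integral_linear_change[OF det]) measurable
  also have "(\<integral>\<^sup>+y. ennreal (cone_fun B c \<phi> (B *v y)) \<partial>lborel)
      = (\<integral>\<^sup>+y. (\<Sum>i\<in>UNIV. ennreal (c i) * (ennreal (y $ i) * ennreal (\<phi> (coord_sum y)) * indicator orthant y)) \<partial>lborel)"
  proof (intro nn_integral_cong)
    fix y :: "real^'n"
    show "ennreal (cone_fun B c \<phi> (B *v y))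
        = (\<Sum>i\<in>UNIV. ennreal (c i) * (ennreal (y $ i) * ennreal (\<phi> (coord_sum y)) * indicator orthant y))"
    proof (cases "y \<in> orthant")
      case True
      then have "ennreal (cone_fun B c \<phi> (B *v y)) = (\<Sum>i\<in>UNIV. ennreal (\<phi> (coord_sum y) * (c i * y $ i)))"
        using c \<phi> by (simp add: cone_fun_matrix_vector_mult[OF det] sum_distrib_left orthant_def)
      also have "\<dots> = (\<Sum>i\<in>UNIV. ennreal (c i) * (ennreal (y $ i) * ennreal (\<phi> (coord_sum y)) * indicator orthant y))"
        using True c \<phi> by (intro sum.cong) (auto simp: ennreal_mult' orthant_def ac_simps)
      finally show ?thesis .
    qed (simp add: cone_fun_matrix_vector_mult[OF det])
  qed
  also have "\<dots> = (\<Sum>i\<in>UNIV. ennreal (c i)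
      * (\<integral>\<^sup>+y. ennreal (y $ i) * ennreal (\<phi> (coord_sum (y::real^'n))) * indicator orthant y \<partial>lborel))"
    by (simp add: nn_integral_sum nn_integral_cmult)
  also have "\<dots> = ennreal (\<Sum>i\<in>UNIV. c i) * ?I"
    using nn_integral_radial_coordinate[where 'n='n, of "\<lambda>t. ennreal (\<phi> t)"] c
    by (simp add: sum_distrib_right[symmetric])
  finally show ?thesis
    using c by (simp add: ennreal_mult' sum_nonneg mult.assoc)
qed

section \<open>Boundary triangulations as families of integer matrices\<close>

definition face_simplex :: "(real^'n) set" where
  "face_simplex = {y \<in> orthant. coord_sum y = 1}"

definition integral_matrix :: "real^'n^'n \<Rightarrow> bool" where
  "integral_matrix B \<longleftrightarrow> (\<forall>i j. B $ i $ j \<in> \<int>)"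

lemma det_integral_matrix: "integral_matrix B \<Longrightarrow> det B \<in> \<int>"
  unfolding det_def integral_matrix_def by (intro Ints_sum Ints_mult Ints_prod) auto

lemma integral_matrix_vector_mult:
  "integral_matrix B \<Longrightarrow> x \<in> lattice \<Longrightarrow> B *v x \<in> lattice"
  unfolding integral_matrix_def lattice_def matrix_vector_mult_def by (auto intro!: Ints_sum Ints_mult)

lemma integral_matrix_mult:
  "integral_matrix A \<Longrightarrow> integral_matrix B \<Longrightarrow> integral_matrix (A ** B)"
  unfolding integral_matrix_def matrix_matrix_mult_def by (auto intro!: Ints_sum Ints_mult)

text \<open>Cramer's rule expresses the coordinates as integral determinants divided by \<open>\<plusminus> 1\<close>.\<close>

lemma unimodular_preimage_lattice:
  fixes B :: "real^'n^'n"
  assumes B: "integral_matrix B" "\<bar>det B\<bar> = 1" and x: "B *v x \<in> lattice"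
  shows "x \<in> lattice"
  unfolding lattice_def
proof (intro CollectI allI)
  fix k
  let ?M = "(\<chi> i j. if j = k then (B *v x) $ i else B $ i $ j) :: real^'n^'n"
  have "integral_matrix ?M"
    using B(1) x by (auto simp: integral_matrix_def lattice_def)
  then have "x $ k * det B \<in> \<int>"
    unfolding cramer_lemma[where A=B and x=x and k=k, symmetric] by (rule det_integral_matrix)
  moreover have "det B = 1 \<or> det B = -1"
    using B(2) by linarith
  ultimately show "x $ k \<in> \<int>"
    by (auto dest: Ints_minus)
qed

text \<open>Subtracting the row \<open>w\<close> from the others turns them into unit vectors, and then only the \<open>j\<close>-th
  entry of \<open>w\<close> counts.\<close>

lemma det_translated_unit_rows:
  fixes w :: "real^'n"
  assumes "finite S" "j \<notin> S"
  shows "det ((\<chi> i. if i = j then w else if i \<in> S then w + axis i 1 else axis i 1) :: real^'n^'n) = w $ j"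
  using assms
proof (induction S)
  case empty
  have row: "row i (mat 1 :: real^'n^'n) = axis i 1" for i
    by (auto simp: row_def mat_def axis_def vec_eq_iff)
  have "(\<Sum>i\<in>UNIV. w $ i *s row i (mat 1 :: real^'n^'n)) = w"
    unfolding row by (rule basis_expansion)
  then show ?case
    using cramer_lemma_transpose[where k=j and x=w and A="mat 1 :: real^'n^'n"]
    by (simp add: row cong: if_cong)
next
  case (insert m S)
  let ?M = "\<lambda>S. (\<chi> i. if i = j then w else if i \<in> S then w + axis i 1 else axis i 1) :: real^'n^'n"
  have "m \<noteq> j"
    using insert.prems by auto
  have row: "row i (?M S) = (if i = j then w else if i \<in> S then w + axis i 1 else axis i 1)" for i
    by (simp add: row_def)
  have "?M (insert m S) = (\<chi> k. if k = m then row m (?M S) + 1 *s row j (?M S) else row k (?M S))"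
    unfolding row using insert.hyps \<open>m \<noteq> j\<close> by (auto simp: vec_eq_iff)
  then have "det (?M (insert m S)) = det (?M S)"
    using det_row_operation[OF \<open>m \<noteq> j\<close>, where c=1 and A="?M S"] by simp
  then show ?case
    using insert by simp
qed

lemma face_simplex_eq_hull: "face_simplex = convex hull (range (\<lambda>i. axis i 1) :: (real^'n) set)"
proof
  show "face_simplex \<subseteq> convex hull (range (\<lambda>i. axis i 1) :: (real^'n) set)"
  proof
    fix y :: "real^'n" assume y: "y \<in> face_simplex"
    have "(\<Sum>i\<in>UNIV. y $ i *\<^sub>R (axis i 1 :: real^'n)) \<in> convex hull (range (\<lambda>i. axis i 1))"
      using y by (intro convex_sum convex_convex_hull)
        (auto simp: face_simplex_def orthant_def coord_sum_def intro: hull_inc)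
    then show "y \<in> convex hull (range (\<lambda>i. axis i 1))"
      by (simp add: basis_expansion flip: vector_scalar_mult_def scalar_mult_eq_scaleR)
  qed
  show "convex hull (range (\<lambda>i. axis i 1)) \<subseteq> (face_simplex :: (real^'n) set)"
  proof (rule hull_minimal)
    show "range (\<lambda>i. axis i 1) \<subseteq> (face_simplex :: (real^'n) set)"
      by (auto simp: face_simplex_def orthant_def) (simp add: axis_def)
    show "convex (face_simplex :: (real^'n) set)"
      by (auto simp: convex_def face_simplex_def orthant_def coord_sum_add coord_sum_scaleR)
  qed
qed

lemma rel_interior_face_simplex:
  assumes "\<And>i. 0 < y $ i" and "coord_sum y = 1"
  shows "y \<in> rel_interior (face_simplex :: (real^'n) set)"
proof -
  let ?S = "Basis :: (real^'n) set"
  have "(\<Sum>b\<in>?S. (y \<bullet> b) *\<^sub>R b) = y"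
    by (rule euclidean_representation)
  moreover have "\<forall>b\<in>?S. 0 < y \<bullet> b"
    using assms by (auto simp: Basis_cart_eq_range inner_axis)
  moreover have "(\<Sum>b\<in>?S. y \<bullet> b) = 1"
    using assms by (simp add: sum_Basis_cart inner_axis coord_sum_def)
  ultimately have "y \<in> {y. \<exists>u. (\<forall>x \<in> ?S. 0 < u x) \<and> sum u ?S = 1 \<and> sum (\<lambda>x. u x *\<^sub>R x) ?S = y}"
    by blast
  also have "\<dots> \<subseteq> rel_interior (convex hull ?S)"
    by (rule explicit_subset_rel_interior_convex_hull_minimal) simp
  finally show ?thesis
    by (simp add: face_simplex_eq_hull Basis_cart_eq_range)
qed

text \<open>A simplex that is integrally isomorphic to the standard one, described by the matrix of its
  vertices. The translation vector is written as \<open>A *v w\<close> so that its vertices are \<open>A\<close> applied to \<open>w\<close>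
  and to \<open>w + axis i 1\<close>.\<close>

lemma unimodular_simplex_matrix:
  fixes A :: "real^'n^'n" and w :: "real^'n"
  assumes A: "integral_matrix A" "det A = 1" and w: "w \<in> lattice"
  obtains B where "integral_matrix B" "det B = w $ j"
    "(\<lambda>x. A *v x + A *v w) ` std_simplex j = (*v) B ` face_simplex"
proof -
  define M where "M = transpose ((\<chi> i. if i = j then w else if i \<in> UNIV - {j} then w + axis i 1 else axis i 1) :: real^'n^'n)"
  have detM: "det M = w $ j"
    unfolding M_def det_transpose by (rule det_translated_unit_rows) auto
  have colM: "M *v axis i 1 = (if i = j then w else w + axis i 1)" for i
    by (auto simp: matrix_vector_mul_component M_def transpose_def column_def vec_eq_iff matrix_vector_mult_basis)
  have "integral_matrix M"
    using w by (auto simp: integral_matrix_def M_def transpose_def lattice_def axis_def)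
  then have "integral_matrix (A ** M)"
    using A by (intro integral_matrix_mult)
  moreover have "det (A ** M) = w $ j"
    using A detM by (simp add: det_mul)
  moreover have "(\<lambda>x. A *v x + A *v w) ` std_simplex j = (*v) (A ** M) ` face_simplex"
  proof -
    have "(\<lambda>x. A *v x + A *v w) ` std_simplex j = (*v) A ` ((\<lambda>x. w + x) ` std_simplex j)"
      by (simp add: image_image matrix_vector_right_distrib add.commute)
    also have "(\<lambda>x. w + x) ` std_simplex j = convex hull ((\<lambda>x. w + x) ` insert 0 {axis i 1 | i. i \<noteq> j})"
      unfolding std_simplex_def by (rule convex_hull_translation[symmetric])
    also have "(\<lambda>x. w + x) ` insert 0 {axis i 1 | i. i \<noteq> j} = (*v) M ` range (\<lambda>i. axis i 1)"
    proof -
      have "(*v) M ` range (\<lambda>i. axis i 1) = (\<lambda>i. if i = j then w else w + axis i 1) ` UNIV"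
        by (simp only: image_image colM)
      then show ?thesis
        by auto
    qed
    also have "convex hull \<dots> = (*v) M ` face_simplex"
      unfolding face_simplex_eq_hull by (rule convex_hull_linear_image[symmetric]) simp
    finally show ?thesis
      by (simp add: image_image matrix_vector_mul_assoc)
  qed
  ultimately show thesis
    by (rule that)
qed

lemma dilate_1 [simp]: "dilate 1 P = P"
  by (simp add: dilate_def)

lemma facet_of_dilate:
  fixes P :: "(real^'n) set"
  assumes k: "k > 0" and F: "F facet_of dilate k P"
  obtains F' where "F' facet_of P" "F = dilate k F'"
proof -
  let ?f = "\<lambda>x::real^'n. (1 / real k) *\<^sub>R x"
  have f: "linear ?f" "inj ?f"
    using k by (auto simp: linear_scaleR inj_on_def)
  have P: "?f ` dilate k P = P"
    using k by (simp add: dilate_def image_image)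
  have "?f ` F facet_of ?f ` dilate k P"
    using F f by (simp add: facet_of_def face_of_linear_image)
  moreover have "F = dilate k (?f ` F)"
    using k by (simp add: dilate_def image_image)
  ultimately show thesis
    using that P by metis
qed

text \<open>A triangulation of the boundary of \<open>kP\<close>, each simplex being replaced by the matrix of its
  vertices. The last condition is the form in which the interiors of the simplices are disjoint.\<close>

definition boundary_cones :: "nat \<Rightarrow> (real^'n) set \<Rightarrow> (real^'n^'n) set \<Rightarrow> bool" where
  "boundary_cones k P \<B> \<longleftrightarrow>
     finite \<B> \<and>
     (\<forall>B\<in>\<B>. integral_matrix B \<and> \<bar>det B\<bar> = real k) \<and>
     frontier (dilate k P) = (\<Union>B\<in>\<B>. (*v) B ` face_simplex) \<and>
     (\<forall>p\<in>frontier (dilate k P). card {B \<in> \<B>. p \<in> (*v) B ` face_simplex} \<le> fact CARD('n)) \<and>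
     (\<forall>B\<in>\<B>. \<forall>C\<in>\<B>. \<forall>y. B \<noteq> C \<longrightarrow> (\<forall>i. 0 < y $ i) \<longrightarrow> coord_sum y = 1 \<longrightarrow> B *v y \<notin> (*v) C ` face_simplex)"

lemma integrally_isomorphicE:
  fixes S T :: "(real^'n) set"
  assumes "integrally_isomorphic S T"
  obtains A :: "real^'n^'n" and v where "A \<in> SL_int" "v \<in> lattice" "T = (\<lambda>x. A *v x + v) ` S"
  using assms by (auto simp: integrally_isomorphic_def)

lemma regular_boundaryE:
  fixes P :: "(real^'n) set"
  assumes "regular_boundary P" and "k > 0"
  obtains \<T> where "triangulates \<T> (frontier (dilate k P))"
    "\<forall>F. F facet_of dilate k P \<longrightarrow> triangulates {T \<in> \<T>. T \<subseteq> F} F"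
    "\<forall>T\<in>\<T>. \<exists>j. integrally_isomorphic (std_simplex j) T"
    "\<forall>p\<in>frontier (dilate k P). card {T \<in> \<T>. p \<in> T} \<le> fact CARD('n)"
  using assms unfolding regular_boundary_def by blast

text \<open>A maximal simplex lies in a single facet, since a relative interior point of it is covered by a
  simplex inside a facet, which can only be the simplex itself. On that facet an integral linear form
  \<open>a\<close> takes the value \<open>\<plusminus> k\<close>, and it vanishes on the edges of the simplex; hence \<open>a \<bullet> (A *v u)\<close> is
  a multiple \<open>c\<close> of \<open>u $ j\<close>. A lattice point on the corresponding facet of \<open>P\<close>, where \<open>a\<close> is
  \<open>\<plusminus> 1\<close>, shows that \<open>c\<close> is \<open>\<plusminus> 1\<close>, and evaluating at a vertex of the simplex gives the determinant.\<close>

lemma exists_boundary_cones: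
  fixes P :: "(real^'n) set"
  assumes P: "integral_polytope P" "reflexive_polytope P" "regular_boundary P" and k: "k > 0"
  shows "\<exists>\<B>. boundary_cones k P \<B>"
proof -
  let ?Q = "dilate k P"
  have polyP: "polytope P"
    using P(1) unfolding integral_polytope_def polytope_def by blast
  have Q_eq: "?Q = (\<lambda>x. real k *\<^sub>R x) ` P"
    by (simp add: dilate_def)
  have "0 \<in> interior P"
    using P(2) by (simp add: reflexive_polytope_def)
  then have "(\<lambda>x. real k *\<^sub>R x) 0 \<in> interior ?Q"
    unfolding Q_eq using k by (subst interior_injective_linear_image) (auto simp: linear_scaleR inj_on_def)
  then have int: "interior ?Q \<noteq> {}"
    by auto
  have "polytope ?Q"
    unfolding Q_eq using polyP by (rule polytope_scaling)
  then have front: "frontier ?Q = \<Union>{F. F facet_of ?Q}"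
    using rel_frontier_of_polyhedron[of ?Q] rel_frontier_nonempty_interior[OF int]
    by (simp add: polytope_imp_polyhedron)
  obtain \<T> where \<T>: "triangulates \<T> (frontier ?Q)"
    "\<forall>F. F facet_of ?Q \<longrightarrow> triangulates {T \<in> \<T>. T \<subseteq> F} F"
    "\<forall>T\<in>\<T>. \<exists>j. integrally_isomorphic (std_simplex j) T"
    "\<forall>p\<in>frontier ?Q. card {T \<in> \<T>. p \<in> T} \<le> fact CARD('n)"
    by (rule regular_boundaryE[OF P(3) k])
  have simpl: "(int CARD('n) - 1) simplex T" if "T \<in> \<T>" for T
    using \<T>(1) that by (auto simp: triangulates_def)
  have meet: "S \<inter> T \<subseteq> rel_frontier S" if "S \<in> \<T>" "T \<in> \<T>" "S \<noteq> T" for S T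
    using \<T>(1) that unfolding triangulates_def by blast
  have Un_T: "\<Union>\<T> = frontier ?Q"
    using \<T>(1) by (simp add: triangulates_def)
  have facet_Un: "\<Union>{T \<in> \<T>. T \<subseteq> F} = F" if "F facet_of ?Q" for F
    using \<T>(2) that by (simp add: triangulates_def)
  have ne: "T \<noteq> {}" if "T \<in> \<T>" for T
    using simpl[OF that] by auto
  have in_facet: "\<exists>F. F facet_of ?Q \<and> T \<subseteq> F" if T: "T \<in> \<T>" for T
  proof -
    obtain x where x: "x \<in> rel_interior T"
      using ne[OF T] rel_interior_eq_empty[OF convex_simplex[OF simpl[OF T]]] by blast
    then have "x \<in> frontier ?Q"
      using T rel_interior_subset[of T] unfolding Un_T[symmetric] by auto
    then obtain F where F: "F facet_of ?Q" "x \<in> F"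
      using front by blast
    then obtain T' where T': "T' \<in> \<T>" "T' \<subseteq> F" "x \<in> T'"
      using facet_Un[OF F(1)] by auto
    have "T' = T"
    proof (rule ccontr)
      assume "T' \<noteq> T"
      then have "x \<in> rel_frontier T"
        using meet[OF T T'(1)] T'(3) x rel_interior_subset[of T] by auto
      with x show False
        by (simp add: rel_frontier_def)
    qed
    with F T' show ?thesis
      by blast
  qed
  have facet_lattice_point: "\<exists>q\<in>F. q \<in> lattice" if "F facet_of P" for F
  proof -
    have "F facet_of dilate 1 P"
      using that by (simp only: dilate_1)
    obtain \<S> where \<S>0: "triangulates \<S> (frontier (dilate 1 P))"
      "\<forall>F. F facet_of dilate 1 P \<longrightarrow> triangulates {T \<in> \<S>. T \<subseteq> F} F"
      "\<forall>T\<in>\<S>. \<exists>j. integrally_isomorphic (std_simplex j) T"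
      "\<forall>p\<in>frontier (dilate 1 P). card {T \<in> \<S>. p \<in> T} \<le> fact CARD('n)"
      by (rule regular_boundaryE[OF P(3) zero_less_one])
    have \<S>: "triangulates {T \<in> \<S>. T \<subseteq> F} F"
      using \<S>0(2) \<open>F facet_of dilate 1 P\<close> by blast
    have "F \<noteq> {}"
      using that by (simp add: facet_of_def)
    moreover have "\<Union>{T \<in> \<S>. T \<subseteq> F} = F"
      using \<S> by (simp add: triangulates_def)
    ultimately obtain T where T: "T \<in> \<S>" "T \<subseteq> F"
      by auto
    then obtain j where "integrally_isomorphic (std_simplex j) T"
      using \<S>0(3) by auto
    then obtain A :: "real^'n^'n" and v where v: "v \<in> lattice" "T = (\<lambda>x. A *v x + v) ` std_simplex j"
      by (rule integrally_isomorphicE)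
    have "0 \<in> std_simplex j"
      by (simp add: std_simplex_def hull_inc)
    then have "A *v 0 + v \<in> T"
      unfolding v(2) by (rule imageI)
    with v T show ?thesis
      by auto
  qed
  have "\<exists>B. integral_matrix B \<and> \<bar>det B\<bar> = real k \<and> T = (*v) B ` face_simplex" if T: "T \<in> \<T>" for T
  proof -
    obtain j where "integrally_isomorphic (std_simplex j) T"
      using \<T>(3) T by auto
    then obtain A :: "real^'n^'n" and v where A: "A \<in> SL_int" "v \<in> lattice" "T = (\<lambda>x. A *v x + v) ` std_simplex j"
      by (rule integrally_isomorphicE)
    have intA: "integral_matrix A" "det A = 1"
      using A(1) by (auto simp: SL_int_def integral_matrix_def)
    define w where "w = matrix_inv A *v v"
    have w: "A *v w = v"
      unfolding w_def using intA by (simp add: matrix_inv_vector_cancel)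
    then have wl: "w \<in> lattice"
      using unimodular_preimage_lattice[of A w] intA A(2) by simp
    obtain B where B: "integral_matrix B" "det B = w $ j" "T = (*v) B ` face_simplex"
      using unimodular_simplex_matrix[OF intA wl, of j] A(3) w by metis
    obtain F F' where F: "F facet_of ?Q" "T \<subseteq> F" "F' facet_of P" "F = dilate k F'"
      using in_facet[OF T] facet_of_dilate[OF k] by metis
    obtain a where a: "a \<in> lattice" "F' \<subseteq> {x. a \<bullet> x = 1} \<or> F' \<subseteq> {x. a \<bullet> x = -1}"
    proof -
      have ip: "(\<Sum>i\<in>UNIV. a $ i * x $ i) = a \<bullet> x" for a x :: "real^'n"
        by (simp add: inner_vec_def)
      show ?thesis
        using P(2) F(3) that unfolding reflexive_polytope_def ip by blast
    qed
    then obtain \<epsilon> where \<epsilon>: "\<bar>\<epsilon>\<bar> = (1::real)" "F' \<subseteq> {x. a \<bullet> x = \<epsilon>}"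
      by (auto intro: that[of 1] that[of "-1"])
    have onT: "a \<bullet> x = real k * \<epsilon>" if "x \<in> T" for x
    proof -
      obtain z where "z \<in> F'" "x = real k *\<^sub>R z"
        using \<open>x \<in> T\<close> F(2,4) by (auto simp: dilate_def)
      with \<epsilon>(2) show ?thesis
        by auto
    qed
    have "0 \<in> std_simplex j" "\<And>i. i \<noteq> j \<Longrightarrow> axis i 1 \<in> std_simplex j"
      unfolding std_simplex_def by (auto intro: hull_inc)
    then have inT: "A *v 0 + v \<in> T" "\<And>i. i \<noteq> j \<Longrightarrow> A *v axis i 1 + v \<in> T"
      unfolding A(3) by blast+
    have av: "a \<bullet> v = real k * \<epsilon>"
      using onT[OF inT(1)] by simp
    have aAi: "a \<bullet> (A *v axis i 1) = 0" if "i \<noteq> j" for i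
      using onT[OF inT(2)[OF that]] av by (simp only: inner_add_right)
    \<comment> \<open>The only edge direction of \<open>A\<close> on which \<open>a\<close> does not vanish is the \<open>j\<close>-th.\<close>
    define c where "c = a \<bullet> (A *v axis j 1)"
    have "c \<in> \<int>"
      unfolding c_def inner_vec_def using a(1) intA
      by (auto intro!: Ints_sum Ints_mult simp: lattice_def integral_matrix_def matrix_vector_mult_basis column_def)
    have aA: "a \<bullet> (A *v u) = u $ j * c" for u
    proof -
      have "A *v u = (\<Sum>i\<in>UNIV. u $ i *\<^sub>R (A *v axis i 1))"
        by (simp add: matrix_mult_sum[of A u] matrix_vector_mult_basis scalar_mult_eq_scaleR)
      then have "a \<bullet> (A *v u) = (\<Sum>i\<in>UNIV. u $ i * (a \<bullet> (A *v axis i 1)))"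
        by (simp add: inner_sum_right)
      also have "\<dots> = (\<Sum>i\<in>UNIV. if i = j then u $ j * c else 0)"
        by (intro sum.cong) (auto simp: aAi c_def)
      finally show ?thesis
        by simp
    qed
    obtain q where q: "q \<in> F'" "q \<in> lattice"
      using facet_lattice_point[OF F(3)] by blast
    define u where "u = matrix_inv A *v q"
    have u: "A *v u = q"
      unfolding u_def using intA by (simp add: matrix_inv_vector_cancel)
    then have "u \<in> lattice"
      using unimodular_preimage_lattice[of A u] intA q(2) by simp
    then have "u $ j \<in> \<int>"
      by (simp add: lattice_def)
    moreover have "\<bar>u $ j\<bar> * \<bar>c\<bar> = 1"
      using aA[of u] u q(1) \<epsilon> by (auto simp: abs_mult[symmetric])
    ultimately have "\<bar>c\<bar> = 1"
    proof -
      assume uj: "u $ j \<in> \<int>" and prod: "\<bar>u $ j\<bar> * \<bar>c\<bar> = 1"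
      from uj prod have "1 \<le> \<bar>u $ j\<bar>"
        by (metis Ints_nonzero_abs_ge1 abs_zero mult_zero_left zero_neq_one)
      moreover from \<open>c \<in> \<int>\<close> prod have "1 \<le> \<bar>c\<bar>"
        by (metis Ints_nonzero_abs_ge1 abs_zero mult_zero_right zero_neq_one)
      ultimately have "\<bar>c\<bar> \<le> \<bar>u $ j\<bar> * \<bar>c\<bar>"
        by (simp add: mult_le_cancel_right1)
      with prod \<open>1 \<le> \<bar>c\<bar>\<close> show ?thesis
        by simp
    qed
    then have "\<bar>w $ j\<bar> = \<bar>real k * \<epsilon>\<bar>"
      using aA[of w] w av by (simp add: abs_mult)
    then have "\<bar>det B\<bar> = real k"
      using B(2) \<epsilon>(1) by (simp add: abs_mult)
    with B show ?thesis
      by blast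
  qed
  then obtain b where b: "\<And>T. T \<in> \<T> \<Longrightarrow> integral_matrix (b T)" "\<And>T. T \<in> \<T> \<Longrightarrow> \<bar>det (b T)\<bar> = real k"
    "\<And>T. T \<in> \<T> \<Longrightarrow> (*v) (b T) ` face_simplex = T"
    by metis
  have "boundary_cones k P (b ` \<T>)"
    unfolding boundary_cones_def
  proof (intro conjI ballI allI impI)
    show "finite (b ` \<T>)"
      using \<T>(1) by (simp add: triangulates_def)
    show "frontier ?Q = (\<Union>B\<in>b ` \<T>. (*v) B ` face_simplex)"
      using \<T>(1) b(3) by (auto simp: triangulates_def)
    show "card {B \<in> b ` \<T>. p \<in> (*v) B ` face_simplex} \<le> fact CARD('n)" if p: "p \<in> frontier ?Q" for p
    proof -
      have "{B \<in> b ` \<T>. p \<in> (*v) B ` face_simplex} = b ` {T \<in> \<T>. p \<in> T}"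
        using b(3) by auto
      also have "card \<dots> \<le> card {T \<in> \<T>. p \<in> T}"
        using \<T>(1) by (intro card_image_le) (auto simp: triangulates_def)
      finally show ?thesis
        using \<T>(4) p by (meson order_trans)
    qed
    show "integral_matrix B" "\<bar>det B\<bar> = real k" if "B \<in> b ` \<T>" for B
      using that b by auto
    show "B *v y \<notin> (*v) C ` face_simplex"
      if BC: "B \<in> b ` \<T>" "C \<in> b ` \<T>" "B \<noteq> C" and y: "\<forall>i. 0 < y $ i" "coord_sum y = 1" for B C y
    proof
      assume inC: "B *v y \<in> (*v) C ` face_simplex"
      obtain S T where ST: "S \<in> \<T>" "T \<in> \<T>" "B = b S" "C = b T" "S \<noteq> T"
        using BC by blast
      have "det B \<noteq> 0"
        using b(2)[OF ST(1)] ST(3) k by auto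
      then have "inj ((*v) B)"
        by (metis injI matrix_inv_vector_cancel(1))
      then have "rel_interior S = (*v) B ` rel_interior face_simplex"
        using b(3)[OF ST(1)] ST(3) rel_interior_injective_linear_image[of "(*v) B" face_simplex] by simp
      then have "B *v y \<in> rel_interior S"
        using rel_interior_face_simplex[of y] y by simp
      moreover have "B *v y \<in> S \<inter> T"
        using calculation rel_interior_subset[of S] inC b(3)[OF ST(2)] ST(4) by auto
      ultimately show False
        using meet[OF ST(1,2,5)] by (auto simp: rel_frontier_def)
    qed
  qed
  then show ?thesis
    by blast
qed

section \<open>Second-order asymptotics of binomial coefficients\<close>

lemma DERIV_prod_one_plus:
  fixes a :: "nat \<Rightarrow> real"
  shows "((\<lambda>x::real. \<Prod>l<m. 1 + a l * x) has_real_derivative (\<Sum>l<m. a l)) (at 0)"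
proof (induction m)
  case (Suc m)
  have "((\<lambda>x. 1 + a m * x) has_real_derivative a m) (at 0)"
    by (auto intro!: derivative_eq_intros)
  from DERIV_mult[OF Suc this] show ?case
    by (simp add: add.commute)
qed simp

text \<open>In this form the binomial coefficient is a function of \<open>1 / k\<close> that is differentiable at \<open>0\<close>.\<close>

lemma fact_mult_choose_eq_prod:
  assumes "k > 0" and m: "real m = real k + c"
  shows "fact n * real (m choose n) = real k ^ n * (\<Prod>l<n. 1 + (c - real l) * (1 / real k))"
proof -
  have "fact n * real (m choose n) = (\<Prod>l = 0..<n. real m - real l)"
    by (simp only: binomial_gbinomial gbinomial_mult_fact)
  also have "\<dots> = (\<Prod>l<n. real k * (1 + (c - real l) * (1 / real k)))"
    using assms(1) by (intro prod.cong) (auto simp: m field_simps)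
  finally show ?thesis
    by (simp add: prod.distrib)
qed

text \<open>As a function of \<open>x = 1 / k\<close>, the left-hand side divided by \<open>k\<^sup>n\<close> has value \<open>2\<close> and derivative
  \<open>n\<close> at \<open>0\<close>, whatever \<open>i\<close> is: the shifts \<open>i\<close> and \<open>n - i\<close> compensate each other. The right-hand side
  has slope \<open>n + 1\<close>.\<close>

lemma eventually_shifted_binomials_less:
  assumes "i \<le> n"
  shows "\<forall>\<^sub>F k in sequentially.
    fact n * (real (k - i + n choose n) + real (k - (n - i) + n choose n))
      < real k ^ n * (2 + (real n + 1) / real k)"
proof -
  let ?G = "\<lambda>x::real. (\<Prod>l<n. 1 + (real (n - i) - real l) * x) + (\<Prod>l<n. 1 + (real i - real l) * x)"
  let ?H = "\<lambda>x::real. 2 + (real n + 1) * x - ?G x"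
  have "(\<Sum>l<n. real (n - i) - real l) + (\<Sum>l<n. real i - real l) = real n * real n - 2 * (\<Sum>l<n. real l)"
    using assms by (simp add: sum_subtractf of_nat_diff) (simp add: algebra_simps)
  also have "2 * (\<Sum>l<n. real l) = real n * (real n - 1)"
    by (induction n) (auto simp: algebra_simps)
  finally have sum: "(\<Sum>l<n. real (n - i) - real l) + (\<Sum>l<n. real i - real l) = real n"
    by (simp add: algebra_simps)
  have "(?G has_real_derivative real n) (at 0)"
    unfolding sum[symmetric] by (intro DERIV_add DERIV_prod_one_plus)
  moreover have "((\<lambda>x. 2 + (real n + 1) * x) has_real_derivative (real n + 1)) (at 0)"
    by (auto intro!: derivative_eq_intros)
  ultimately have "(?H has_real_derivative (real n + 1 - real n)) (at 0)"
    by (intro DERIV_diff)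
  then obtain d where d: "d > 0" "\<And>h. 0 < h \<Longrightarrow> h < d \<Longrightarrow> ?H 0 < ?H (0 + h)"
    using DERIV_pos_inc_right[of ?H "real n + 1 - real n" 0] by auto
  have "\<forall>\<^sub>F k in sequentially. k > nat \<lceil>1 / d\<rceil> + n"
    by (rule eventually_gt_at_top)
  then show ?thesis
  proof eventually_elim
    fix k assume k: "k > nat \<lceil>1 / d\<rceil> + n"
    then have k0: "k > 0" "n \<le> k"
      by auto
    have "1 / d \<le> real (nat \<lceil>1 / d\<rceil>)"
      by (rule real_nat_ceiling_ge)
    also have "\<dots> < real k"
      using k by simp
    finally have "1 / real k < d"
      using d(1) k0 by (simp add: field_simps)
    then have "?G (1 / real k) < 2 + (real n + 1) * (1 / real k)"
      using d(2)[of "1 / real k"] k0 by simp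
    moreover have "fact n * (real (k - i + n choose n) + real (k - (n - i) + n choose n))
        = real k ^ n * ?G (1 / real k)"
    proof -
      have "fact n * real (k - i + n choose n) = real k ^ n * (\<Prod>l<n. 1 + (real (n - i) - real l) * (1 / real k))"
        using k0 assms by (intro fact_mult_choose_eq_prod) (auto simp: of_nat_diff)
      moreover have "fact n * real (k - (n - i) + n choose n) = real k ^ n * (\<Prod>l<n. 1 + (real i - real l) * (1 / real k))"
        using k0 assms by (intro fact_mult_choose_eq_prod) (auto simp: of_nat_diff)
      ultimately show ?thesis
        by (simp only: distrib_left)
    qed
    ultimately show "fact n * (real (k - i + n choose n) + real (k - (n - i) + n choose n))
      < real k ^ n * (2 + (real n + 1) / real k)"
      using k0 by simp
  qed
qed

section \<open>Counting lattice points by half-open cones\<close>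

text \<open>Pascal's rule, splitting by whether the value at the new index is zero.\<close>

lemma finite_card_bounded_sum:
  fixes A :: "'a set"
  assumes "finite A"
  shows "finite {f :: 'a \<Rightarrow> nat. (\<forall>i. i \<notin> A \<longrightarrow> f i = 0) \<and> sum f A \<le> m} \<and>
    card {f :: 'a \<Rightarrow> nat. (\<forall>i. i \<notin> A \<longrightarrow> f i = 0) \<and> sum f A \<le> m} \<le> (m + card A) choose card A"
  using assms
proof (induction A arbitrary: m)
  case empty
  have "{f :: 'a \<Rightarrow> nat. (\<forall>i. i \<notin> {} \<longrightarrow> f i = 0) \<and> sum f {} \<le> m} = {\<lambda>_. 0}"
    by auto
  then show ?case
    by simp
next
  case (insert a A)
  let ?W = "\<lambda>A m. {f :: 'a \<Rightarrow> nat. (\<forall>i. i \<notin> A \<longrightarrow> f i = 0) \<and> sum f A \<le> m}"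
  let ?n = "card A"
  have card: "card (insert a A) = Suc ?n"
    using insert.hyps by simp
  show ?case
    unfolding card
  proof (induction m)
    case 0
    have "f i = 0" if "f \<in> ?W (insert a A) 0" for f i
      using that insert.hyps by (cases "i \<in> insert a A") auto
    then have "?W (insert a A) 0 = {\<lambda>_. 0}"
      by (auto simp: fun_eq_iff)
    then show ?case
      by simp
  next
    case (Suc m)
    have sub: "?W (insert a A) (Suc m) \<subseteq> ?W A (Suc m) \<union> (\<lambda>f. f(a := Suc (f a))) ` ?W (insert a A) m"
    proof
      fix f assume f: "f \<in> ?W (insert a A) (Suc m)"
      show "f \<in> ?W A (Suc m) \<union> (\<lambda>f. f(a := Suc (f a))) ` ?W (insert a A) m"
      proof (cases "f a")
        case 0
        then have "f i = 0" if "i \<notin> A" for i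
          using f that by (cases "i = a") auto
        then have "f \<in> ?W A (Suc m)"
          using f insert.hyps 0 by simp
        then show ?thesis ..
      next
        case (Suc r)
        let ?g = "f(a := r)"
        have "sum ?g A = sum f A"
          using insert.hyps by (intro sum.cong) auto
        then have g: "?g \<in> ?W (insert a A) m"
          using f insert.hyps Suc by auto
        have "f = ?g(a := Suc (?g a))"
          using Suc by auto
        then have "f \<in> (\<lambda>f. f(a := Suc (f a))) ` ?W (insert a A) m"
          using g by (rule image_eqI[where f = "\<lambda>f. f(a := Suc (f a))" and x = ?g])
        then show ?thesis ..
      qed
    qed
    have fin: "finite (?W A (Suc m) \<union> (\<lambda>f. f(a := Suc (f a))) ` ?W (insert a A) m)"
      using insert.IH[of "Suc m"] Suc.IH by blast
    have "card (?W (insert a A) (Suc m)) \<le> card (?W A (Suc m)) + card ((\<lambda>f. f(a := Suc (f a))) ` ?W (insert a A) m)"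
      using card_mono[OF fin sub] card_Un_le order_trans by blast
    also have "\<dots> \<le> (Suc m + ?n choose ?n) + (m + Suc ?n choose Suc ?n)"
      using insert.IH[of "Suc m"] Suc.IH
      by (intro add_mono) (auto intro: order_trans[OF card_image_le])
    also have "\<dots> = Suc m + Suc ?n choose Suc ?n"
      by simp
    finally show ?case
      using finite_subset[OF sub fin] by simp
  qed
qed

lemma finite_card_bounded_sum_positive_on:
  fixes I :: "'n::finite set"
  assumes "card I \<le> m"
  shows "finite {f :: 'n \<Rightarrow> nat. (\<forall>i\<in>I. 1 \<le> f i) \<and> sum f UNIV \<le> m} \<and>
    card {f :: 'n \<Rightarrow> nat. (\<forall>i\<in>I. 1 \<le> f i) \<and> sum f UNIV \<le> m} \<le> (m - card I + CARD('n)) choose CARD('n)"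
proof -
  let ?W = "{f :: 'n \<Rightarrow> nat. (\<forall>i. i \<notin> UNIV \<longrightarrow> f i = 0) \<and> sum f UNIV \<le> m - card I}"
  let ?s = "\<lambda>f i. f i + of_bool (i \<in> I) :: nat"
  have W: "finite ?W" "card ?W \<le> (m - card I + CARD('n)) choose CARD('n)"
    using finite_card_bounded_sum[of "UNIV :: 'n set" "m - card I"] by auto
  have sub: "{f :: 'n \<Rightarrow> nat. (\<forall>i\<in>I. 1 \<le> f i) \<and> sum f UNIV \<le> m} \<subseteq> ?s ` ?W"
  proof
    fix f :: "'n \<Rightarrow> nat" assume f: "f \<in> {f. (\<forall>i\<in>I. 1 \<le> f i) \<and> sum f UNIV \<le> m}"
    define g where "g = (\<lambda>i. f i - of_bool (i \<in> I))"
    have fg: "f i = ?s g i" for i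
      using f by (auto simp: g_def)
    then have "sum f UNIV = sum (?s g) UNIV"
      by simp
    also have "\<dots> = sum g UNIV + card I"
      by (simp add: sum.distrib)
    finally have "g \<in> ?W"
      using f by auto
    moreover have "f = ?s g"
      using fg by auto
    ultimately show "f \<in> ?s ` ?W"
      by blast
  qed
  show ?thesis
    using finite_subset[OF sub] W card_mono[OF _ sub] card_image_le[OF W(1), of ?s] by auto
qed

text \<open>The gauge of \<open>P\<close> is \<open>1\<close> on the frontier and at most \<open>1\<close> on \<open>P\<close>: a point \<open>y = (s / t) z\<close> with
  \<open>s < t\<close> would lie in the interior.\<close>

lemma frontier_scale_le:
  fixes P :: "'a::euclidean_space set"
  assumes "convex P" "0 \<in> interior P" "y \<in> frontier P" "z \<in> P" "0 \<le> s" and eq: "t *\<^sub>R y = s *\<^sub>R z"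
  shows "t \<le> s"
proof (rule ccontr)
  assume "\<not> t \<le> s"
  then have st: "s < t" "0 < t"
    using \<open>0 \<le> s\<close> by auto
  have "z - (1 - s / t) *\<^sub>R (z - 0) \<in> interior P"
    using assms st by (intro mem_interior_closure_convex_shrink) (auto simp: closure_subset[THEN subsetD])
  moreover have "z - (1 - s / t) *\<^sub>R (z - 0) = y"
  proof -
    have "y = (1 / t) *\<^sub>R (t *\<^sub>R y)"
      using st by simp
    also have "\<dots> = (s / t) *\<^sub>R z"
      unfolding eq by simp
    finally show ?thesis
      by (simp add: algebra_simps)
  qed
  ultimately show False
    using assms(3) by (simp add: frontier_def)
qed

lemma on_ray_through_frontier:
  fixes P :: "'a::euclidean_space set"
  assumes "bounded P" "0 \<in> interior P" "x \<noteq> 0"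
  obtains t y where "0 < t" "y \<in> frontier P" "x = t *\<^sub>R y"
proof -
  obtain d where "0 < d" "0 + d *\<^sub>R x \<in> frontier P"
    using ray_to_frontier[OF assms] by blast
  then show thesis
    by (intro that[of "1 / d" "d *\<^sub>R x"]) auto
qed

lemma frontier_dilate:
  fixes P :: "(real^'n) set"
  assumes "k > 0"
  shows "frontier (dilate k P) = dilate k (frontier P)"
proof -
  let ?f = "\<lambda>x::real^'n. real k *\<^sub>R x"
  have f: "linear ?f" "inj ?f"
    using assms by (auto simp: linear_scaleR inj_on_def)
  have "closure (?f ` P) = ?f ` closure P"
    by (rule closure_injective_linear_image[OF f, symmetric])
  moreover have "interior (?f ` P) = ?f ` interior P"
    by (rule interior_injective_linear_image[OF f])
  ultimately show ?thesis
    by (simp add: frontier_def dilate_def image_set_diff[OF f(2)])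
qed

lemma face_simplex_normalize:
  assumes "y \<in> orthant" "0 < coord_sum y"
  shows "(1 / coord_sum y) *\<^sub>R y \<in> face_simplex"
  using assms by (auto simp: face_simplex_def orthant_def coord_sum_scaleR)

lemma coord_sum_pos:
  assumes "y \<in> orthant" "y \<noteq> 0"
  shows "0 < coord_sum y"
proof -
  obtain i where "y $ i \<noteq> 0"
    using assms(2) by (auto simp: vec_eq_iff)
  then have "0 < y $ i"
    using assms(1) by (auto simp: orthant_def order_less_le)
  also have "y $ i \<le> coord_sum y"
    using assms(1) unfolding coord_sum_def orthant_def by (intro member_le_sum) auto
  finally show ?thesis .
qed

context
  fixes P :: "(real^'n) set" and \<B> :: "(real^'n^'n) set"
  assumes P: "convex P" "compact P" "0 \<in> interior P" and \<B>: "boundary_cones 1 P \<B>"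
begin

lemma unit_cones_finite: "finite \<B>"
  and unit_cones_frontier: "frontier P = (\<Union>B\<in>\<B>. (*v) B ` face_simplex)"
  and unit_cones_unimodular: "B \<in> \<B> \<Longrightarrow> integral_matrix B" "B \<in> \<B> \<Longrightarrow> \<bar>det B\<bar> = 1"
  using \<B> by (auto simp: boundary_cones_def dilate_def)

lemma unit_cones_disjoint:
  "B \<in> \<B> \<Longrightarrow> C \<in> \<B> \<Longrightarrow> B \<noteq> C \<Longrightarrow> (\<And>i. 0 < y $ i) \<Longrightarrow> coord_sum y = 1 \<Longrightarrow> B *v y \<notin> (*v) C ` face_simplex"
  using \<B> unfolding boundary_cones_def by blast

lemma unit_cones_cover: "\<exists>B\<in>\<B>. matrix_inv B *v x \<in> orthant"
proof -
  have nonzero: "\<exists>B\<in>\<B>. matrix_inv B *v x \<in> orthant" if x: "x \<noteq> 0" for x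
  proof -
    obtain t y where t: "0 < t" "y \<in> frontier P" "x = t *\<^sub>R y"
      using on_ray_through_frontier[OF compact_imp_bounded[OF P(2)] P(3) x] .
    then obtain B z where B: "B \<in> \<B>" "z \<in> face_simplex" "y = B *v z"
      using unit_cones_frontier by auto
    have "matrix_inv B *v x = t *\<^sub>R z"
      using unit_cones_unimodular(2)[OF B(1)] matrix_inv_vector_cancel(1)[of B z]
      by (auto simp: t(3) B(3) matrix_vector_mult_scaleR)
    then have "matrix_inv B *v x \<in> orthant"
      using B(2) t(1) by (simp add: face_simplex_def orthant_def)
    with B(1) show ?thesis ..
  qed
  show ?thesis
  proof (cases "x = 0")
    case True
    have "axis undefined 1 \<noteq> (0 :: real^'n)"
      by simp
    then obtain B where "B \<in> \<B>"
      using nonzero by blast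
    with True show ?thesis
      by (auto simp: orthant_def)
  qed (rule nonzero)
qed

lemma coord_sum_le_of_mem_dilate:
  assumes "B \<in> \<B>" "y \<in> orthant" "B *v y = s *\<^sub>R z" "z \<in> P" "0 \<le> s"
  shows "coord_sum y \<le> s"
proof (cases "y = 0")
  case True
  with assms show ?thesis
    by (simp add: coord_sum_def)
next
  case False
  let ?t = "coord_sum y"
  have t: "0 < ?t"
    using coord_sum_pos[OF assms(2) False] .
  have "B *v ((1 / ?t) *\<^sub>R y) \<in> frontier P"
    unfolding unit_cones_frontier using assms(1) face_simplex_normalize[OF assms(2) t] by blast
  moreover have "?t *\<^sub>R (B *v ((1 / ?t) *\<^sub>R y)) = s *\<^sub>R z"
    using t assms(3) by (simp add: matrix_vector_mult_scaleR)
  ultimately show ?thesis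
    using frontier_scale_le[OF P(1,3)] assms by blast
qed

text \<open>Infinitely many of the points \<open>p + \<xi> / m\<close> lie in one and the same cone. Letting \<open>m\<close> grow, the
  coordinates of \<open>p\<close> in this cone are nonnegative, and they are positive where \<open>\<xi>\<close> has a negative
  coordinate.\<close>

lemma lattice_point_half_open_cone:
  assumes p: "p \<in> dilate k P" "p \<in> lattice"
  shows "\<exists>B\<in>\<B>. \<exists>f :: 'n \<Rightarrow> nat. p = B *v (\<chi> i. real (f i)) \<and> sum f UNIV \<le> k
    \<and> (\<forall>i. (matrix_inv B *v \<xi>) $ i < 0 \<longrightarrow> 1 \<le> f i)"
proof -
  \<comment> \<open>\<open>c m\<close> is a cone containing the \<open>m\<close>-th perturbation of \<open>p\<close>.\<close>
  define q where "q = (\<lambda>m::nat. p + (1 / real (Suc m)) *\<^sub>R \<xi>)"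
  define c where "c = (\<lambda>m. SOME B. B \<in> \<B> \<and> matrix_inv B *v q m \<in> orthant)"
  have c: "c m \<in> \<B>" "matrix_inv (c m) *v q m \<in> orthant" for m
    using someI_ex[of "\<lambda>B. B \<in> \<B> \<and> matrix_inv B *v q m \<in> orthant"] unit_cones_cover[of "q m"]
    unfolding c_def by blast+
  have "finite (c ` UNIV)"
    using unit_cones_finite c(1) by (meson finite_subset image_subsetI)
  then obtain m0 where "infinite {m \<in> UNIV. c m = c m0}"
    using pigeonhole_infinite[of UNIV c] by auto
  define B where "B = c m0"
  have B: "B \<in> \<B>" "infinite {m. c m = B}"
    using c \<open>infinite {m \<in> UNIV. c m = c m0}\<close> by (auto simp: B_def)
  have det: "det B \<noteq> 0"
    using unit_cones_unimodular(2)[OF B(1)] by auto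
  define l where "l = matrix_inv B *v p"
  define u where "u = matrix_inv B *v \<xi>"
  have Bl: "B *v l = p"
    unfolding l_def using det by (simp add: matrix_inv_vector_cancel)
  have lu: "0 \<le> l $ i + u $ i / real (Suc m)" if "c m = B" for i m
    using c(2)[of m] that
    by (simp add: q_def l_def u_def matrix_vector_right_distrib matrix_vector_mult_scaleR orthant_def)
  have l_nonneg: "0 \<le> l $ i" for i
  proof (rule ccontr)
    assume neg: "\<not> 0 \<le> l $ i"
    obtain N where N: "\<bar>u $ i\<bar> / - (l $ i) < real N"
      using reals_Archimedean2 by blast
    obtain m where m: "m \<ge> N" "c m = B"
      using B(2) unfolding infinite_nat_iff_unbounded_le by blast
    have "\<bar>u $ i\<bar> < real N * - (l $ i)"
      using N neg by (subst (asm) pos_divide_less_eq) auto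
    also have "\<dots> \<le> real (Suc m) * - (l $ i)"
      using m(1) neg by (intro mult_right_mono) auto
    finally have "u $ i < real (Suc m) * - (l $ i)"
      by linarith
    then have "u $ i / real (Suc m) < - (l $ i)"
      by (subst pos_divide_less_eq) (auto simp: mult.commute)
    with lu[OF m(2), of i] show False
      by linarith
  qed
  have l_pos: "0 < l $ i" if "u $ i < 0" for i
  proof -
    have "c m0 = B"
      by (simp add: B_def)
    moreover have "u $ i / real (Suc m0) < 0"
      using that by (simp add: divide_neg_pos)
    ultimately show ?thesis
      using lu[of m0 i] by linarith
  qed
  have "l \<in> lattice"
    using unimodular_preimage_lattice[of B l] unit_cones_unimodular[OF B(1)] Bl p(2) by simp
  then have "l $ i \<in> \<nat>" for i
    using l_nonneg[of i] by (simp add: lattice_def Nats_altdef2)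
  then have "\<forall>i. \<exists>r::nat. l $ i = real r"
    by (metis Nats_cases)
  then obtain f :: "'n \<Rightarrow> nat" where f: "\<And>i. l $ i = real (f i)"
    by metis
  have "coord_sum l \<le> real k"
  proof -
    obtain z where "z \<in> P" "p = real k *\<^sub>R z"
      using p(1) by (auto simp: dilate_def)
    then show ?thesis
      using coord_sum_le_of_mem_dilate[OF B(1), of l "real k" z] Bl l_nonneg by (auto simp: orthant_def)
  qed
  then have "sum f UNIV \<le> k"
    by (simp add: coord_sum_def f flip: of_nat_sum)
  moreover have "l = (\<chi> i. real (f i))"
    by (simp add: vec_eq_iff f)
  moreover have "1 \<le> f i" if "u $ i < 0" for i
    using l_pos[OF that] f[of i] by simp
  ultimately show ?thesis
    using B(1) Bl unfolding u_def by (intro bexI[of _ B] exI[of _ f]) auto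
qed

lemma chi_dilate_le:
  assumes k: "CARD('n) \<le> k"
  shows "chi (dilate k P) \<le> (\<Sum>B\<in>\<B>. (k - card {i. (matrix_inv B *v \<xi>) $ i < 0} + CARD('n)) choose CARD('n))"
proof -
  let ?I = "\<lambda>B :: real^'n^'n. {i. (matrix_inv B *v \<xi>) $ i < 0}"
  let ?W = "\<lambda>B. {f :: 'n \<Rightarrow> nat. (\<forall>i\<in>?I B. 1 \<le> f i) \<and> sum f UNIV \<le> k}"
  let ?h = "\<lambda>B f. B *v (\<chi> i. real (f i))"
  have I: "card (?I B) \<le> k" for B
    using card_mono[of "UNIV :: 'n set" "?I B"] k by auto
  note W = finite_card_bounded_sum_positive_on[OF I]
  have "dilate k P \<inter> lattice \<subseteq> (\<Union>B\<in>\<B>. ?h B ` ?W B)"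
    using lattice_point_half_open_cone[of _ k \<xi>] by fastforce
  then have "chi (dilate k P) \<le> card (\<Union>B\<in>\<B>. ?h B ` ?W B)"
    unfolding chi_def using W unit_cones_finite by (intro card_mono finite_UN_I) auto
  also have "\<dots> \<le> (\<Sum>B\<in>\<B>. card (?h B ` ?W B))"
    by (rule card_UN_le[OF unit_cones_finite])
  also have "\<dots> \<le> (\<Sum>B\<in>\<B>. (k - card (?I B) + CARD('n)) choose CARD('n))"
    using W by (intro sum_mono) (meson card_image_le order_trans)
  finally show ?thesis .
qed

text \<open>The directions to be avoided form finitely many hyperplanes.\<close>

lemma exists_generic_direction: "\<exists>\<xi>. \<forall>B\<in>\<B>. \<forall>i. (matrix_inv B *v \<xi>) $ i \<noteq> 0"
proof -
  have "negligible {\<xi>. (matrix_inv B *v \<xi>) $ i = 0}" if B: "B \<in> \<B>" for B and i :: 'n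
  proof -
    let ?r = "row i (matrix_inv B)"
    have eq: "(matrix_inv B *v \<xi>) $ i = ?r \<bullet> \<xi>" for \<xi>
      by (simp add: matrix_vector_mul_component row_def inner_vec_def matrix_vector_mult_def)
    have "det B \<noteq> 0"
      using unit_cones_unimodular(2)[OF B] by auto
    then have "(matrix_inv B *v (B *v axis i 1)) $ i = 1"
      by (subst matrix_inv_vector_cancel) (auto simp: axis_def)
    then have "?r \<noteq> 0"
      unfolding eq by auto
    then show ?thesis
      unfolding eq by (intro negligible_hyperplane) auto
  qed
  then have "negligible (\<Union>B\<in>\<B>. \<Union>i. {\<xi>. (matrix_inv B *v \<xi>) $ i = 0})"
    using unit_cones_finite by (intro negligible_Union finite_imageI) auto
  then have "(\<Union>B\<in>\<B>. \<Union>i. {\<xi>. (matrix_inv B *v \<xi>) $ i = 0}) \<noteq> UNIV"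
    by (metis non_negligible_UNIV)
  then show ?thesis
    by blast
qed

lemma emeasure_open_corner:
  "ennreal (1 / fact CARD('n)) \<le> emeasure lborel {y::real^'n. (\<forall>i. 0 < y $ i) \<and> coord_sum y \<le> 1}"
proof -
  let ?O = "{y::real^'n. (\<forall>i. 0 < y $ i) \<and> coord_sum y \<le> 1}"
  let ?N = "\<Union>i. {y::real^'n. y $ i = 0}"
  have "negligible ?N"
    by (intro negligible_Union) (auto simp: negligible_standard_hyperplane_cart)
  then have "emeasure lebesgue ?N = 0"
    unfolding negligible_iff_null_sets by (rule null_setsD1)
  moreover have N: "?N \<in> sets borel"
    by measurable
  ultimately have "emeasure lborel ?N = 0"
    by simp
  have O: "?O \<in> sets borel"
    by measurable
  have "ennreal (1 / fact CARD('n)) = emeasure lborel {y \<in> orthant. coord_sum (y::real^'n) \<le> 1}"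
    by (subst emeasure_corner_simplex) auto
  also have "\<dots> \<le> emeasure lborel (?O \<union> ?N)"
    using O N by (intro emeasure_mono) (auto simp: orthant_def order_less_le)
  also have "\<dots> \<le> emeasure lborel ?O + emeasure lborel ?N"
    using O N by (intro emeasure_subadditive) auto
  finally show ?thesis
    using \<open>emeasure lborel ?N = 0\<close> by simp
qed

text \<open>The simplices spanned by the origin and a boundary simplex have volume \<open>1 / n!\<close>, lie in \<open>P\<close>, and
  do not overlap: a common interior point would be the multiple of a common point of two boundary
  simplices that is interior to one of them.\<close>

lemma card_unit_cones_le_volume: "real (card \<B>) / fact CARD('n) \<le> measure lebesgue P"
proof -
  let ?O = "{y::real^'n. (\<forall>i. 0 < y $ i) \<and> coord_sum y \<le> 1}"
  let ?D = "\<lambda>B. (*v) B ` ?O"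
  have inv: "matrix_inv B *v (B *v y) = y" "B *v (matrix_inv B *v y) = y" if "B \<in> \<B>" for B y
    using unit_cones_unimodular(2)[OF that] matrix_inv_vector_cancel[of B] by auto
  have D: "?D B = (\<lambda>x. matrix_inv B *v x) -` ?O" if "B \<in> \<B>" for B
    using inv[OF that] by (force simp: image_iff)
  have [measurable]: "?O \<in> sets borel"
    by measurable
  have lin_meas: "(\<lambda>x. (A::real^'n^'n) *v x) \<in> borel_measurable borel" for A
    by (intro borel_measurable_continuous_onI linear_continuous_on matrix_vector_mul_bounded_linear)
  have D_meas: "?D B \<in> sets borel" if "B \<in> \<B>" for B
    unfolding D[OF that] using measurable_sets[OF lin_meas, of ?O] by simp
  have pos: "y \<in> orthant \<and> 0 < coord_sum y" if "y \<in> ?O" for y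
    using that by (auto simp: orthant_def coord_sum_def less_imp_le intro: sum_pos)
  have front: "B *v ((1 / coord_sum y) *\<^sub>R y) \<in> frontier P" if "B \<in> \<B>" "y \<in> ?O" for B y
    unfolding unit_cones_frontier using that face_simplex_normalize[of y] pos[of y] by blast
  have P_closed: "closed P"
    using P(2) compact_imp_closed by blast
  have scaled: "B *v y = coord_sum y *\<^sub>R (B *v ((1 / coord_sum y) *\<^sub>R y))" if "y \<in> ?O" for B and y :: "real^'n"
    using pos[OF that] by (simp add: matrix_vector_mult_scaleR)
  have sub: "?D B \<subseteq> P" if "B \<in> \<B>" for B
  proof
    fix x assume "x \<in> ?D B"
    then obtain y where y: "y \<in> ?O" "x = B *v y"
      by blast
    let ?z = "B *v ((1 / coord_sum y) *\<^sub>R y)"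
    have "?z \<in> P"
      using front[OF that y(1)] P_closed by (auto simp: frontier_def)
    then have "(1 - coord_sum y) *\<^sub>R 0 + coord_sum y *\<^sub>R ?z \<in> P"
      using P(1,3) interior_subset[of P] y(1) pos[OF y(1)] by (intro convexD) auto
    then show "x \<in> P"
      using scaled[OF y(1), of B] y(2) by simp
  qed
  have "disjoint_family_on ?D \<B>"
    unfolding disjoint_family_on_def
  proof (intro ballI impI, rule ccontr)
    fix B C assume BC: "B \<in> \<B>" "C \<in> \<B>" "B \<noteq> C" and "?D B \<inter> ?D C \<noteq> {}"
    then obtain y z where yz: "y \<in> ?O" "z \<in> ?O" "B *v y = C *v z"
      by blast
    let ?s = "coord_sum y" and ?t = "coord_sum z"
    let ?y = "B *v ((1 / ?s) *\<^sub>R y)" and ?z = "C *v ((1 / ?t) *\<^sub>R z)"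
    have eq: "?s *\<^sub>R ?y = ?t *\<^sub>R ?z"
      using scaled[OF yz(1), of B] scaled[OF yz(2), of C] yz(3) by simp
    have inP: "?y \<in> P" "?z \<in> P"
      using front[OF BC(1) yz(1)] front[OF BC(2) yz(2)] P_closed by (auto simp: frontier_def)
    have "?s = ?t"
    proof (rule antisym)
      show "?s \<le> ?t"
        using frontier_scale_le[OF P(1,3) front[OF BC(1) yz(1)] inP(2) _ eq] pos[OF yz(2)] by simp
      show "?t \<le> ?s"
        using frontier_scale_le[OF P(1,3) front[OF BC(2) yz(2)] inP(1) _ eq[symmetric]] pos[OF yz(1)] by simp
    qed
    then have "?y = ?z"
      using eq pos[OF yz(1)] by simp
    moreover have "?z \<in> (*v) C ` face_simplex"
      using face_simplex_normalize[of z] pos[OF yz(2)] by blast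
    moreover have "?y \<notin> (*v) C ` face_simplex"
      using yz(1) pos[OF yz(1)] by (intro unit_cones_disjoint[OF BC]) (auto simp: coord_sum_scaleR)
    ultimately show False
      by simp
  qed
  then have "(\<Sum>B\<in>\<B>. emeasure lborel (?D B)) = emeasure lborel (\<Union>B\<in>\<B>. ?D B)"
    using D_meas unit_cones_finite by (intro sum_emeasure) auto
  also have "\<dots> \<le> emeasure lborel P"
    using sub P_closed by (intro emeasure_mono) auto
  also have "\<dots> = ennreal (measure lebesgue P)"
    using emeasure_eq_measure2[OF lmeasurable_compact[OF P(2)]] P_closed by simp
  finally have le: "(\<Sum>B\<in>\<B>. emeasure lborel (?D B)) \<le> ennreal (measure lebesgue P)" .
  have "ennreal (1 / fact CARD('n)) \<le> emeasure lborel (?D B)" if "B \<in> \<B>" for B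
  proof -
    have "emeasure lborel (?D B) = (\<integral>\<^sup>+x. indicator (?D B) x \<partial>lborel)"
      using D_meas[OF that] by simp
    also have "\<dots> = ennreal \<bar>det B\<bar> * (\<integral>\<^sup>+x. indicator (?D B) (B *v x) \<partial>lborel)"
      using D_meas[OF that] unit_cones_unimodular(2)[OF that] by (intro nn_integral_linear_change) auto
    also have "\<dots> = (\<integral>\<^sup>+x. indicator ?O x \<partial>lborel)"
      using unit_cones_unimodular(2)[OF that] inv(1)[OF that]
      by (auto simp: D[OF that] indicator_def intro!: nn_integral_cong)
    also have "\<dots> = emeasure lborel ?O"
      by simp
    finally show ?thesis
      using emeasure_open_corner by simp
  qed
  then have "(\<Sum>B\<in>\<B>. ennreal (1 / fact CARD('n))) \<le> (\<Sum>B\<in>\<B>. emeasure lborel (?D B))"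
    by (rule sum_mono)
  then have "ennreal (real (card \<B>) / fact CARD('n)) \<le> (\<Sum>B\<in>\<B>. emeasure lborel (?D B))"
    by (simp add: sum_ennreal[symmetric] ennreal_of_nat_eq_real_of_nat ennreal_mult[symmetric] del: sum_ennreal)
  from order_trans[OF this le] show ?thesis
    by simp
qed

text \<open>Counting with the direction \<open>\<xi>\<close> and with \<open>- \<xi>\<close> requires positivity of complementary sets of
  coordinates in each cone, which is the situation of the lemma on shifted binomial coefficients.\<close>

lemma eventually_chi_dilate_less:
  "\<forall>\<^sub>F k in sequentially.
    real (chi (dilate k P)) < real k ^ CARD('n) * measure lebesgue P * (1 + (real CARD('n) + 1) / (2 * real k))"
proof -
  let ?n = "CARD('n)"
  obtain \<xi> where \<xi>: "\<forall>B\<in>\<B>. \<forall>i. (matrix_inv B *v \<xi>) $ i \<noteq> 0"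
    using exists_generic_direction by blast
  define a where "a = (\<lambda>B :: real^'n^'n. card {i. (matrix_inv B *v \<xi>) $ i < 0})"
  have a_le: "a B \<le> ?n" for B
    unfolding a_def using card_mono[of "UNIV :: 'n set"] by simp
  \<comment> \<open>By genericity, a coordinate of \<open>- \<xi>\<close> is negative exactly if that of \<open>\<xi>\<close> is not.\<close>
  have opposite: "card {i. (matrix_inv B *v (- \<xi>)) $ i < 0} = ?n - a B" if "B \<in> \<B>" for B
  proof -
    have "matrix_inv B *v (- \<xi>) = - (matrix_inv B *v \<xi>)"
      using matrix_vector_mult_scaleR[of "matrix_inv B" "- 1" \<xi>] by simp
    then have "{i. (matrix_inv B *v (- \<xi>)) $ i < 0} = UNIV - {i. (matrix_inv B *v \<xi>) $ i < 0}"
      using \<xi> that by (auto simp: not_less order_less_le)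
    then show ?thesis
      by (simp add: a_def card_Diff_subset)
  qed
  have "\<forall>\<^sub>F k in sequentially. \<forall>i\<in>{..?n}.
      fact ?n * (real (k - i + ?n choose ?n) + real (k - (?n - i) + ?n choose ?n))
        < real k ^ ?n * (2 + (real ?n + 1) / real k)"
    by (intro eventually_ball_finite ballI eventually_shifted_binomials_less) auto
  moreover have "\<forall>\<^sub>F k in sequentially. ?n \<le> k"
    by (rule eventually_ge_at_top)
  ultimately show ?thesis
  proof eventually_elim
    fix k
    let ?E = "real k ^ ?n * (2 + (real ?n + 1) / real k)"
    assume small: "\<forall>i\<in>{..?n}. fact ?n * (real (k - i + ?n choose ?n) + real (k - (?n - i) + ?n choose ?n)) < ?E"
      and k: "?n \<le> k"
    have "0 < k"
      using k zero_less_card_finite[where 'a='n] by linarith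
    have "chi (dilate k P) \<le> (\<Sum>B\<in>\<B>. (k - a B + ?n) choose ?n)"
      unfolding a_def by (rule chi_dilate_le[OF k])
    moreover have "chi (dilate k P) \<le> (\<Sum>B\<in>\<B>. (k - (?n - a B) + ?n) choose ?n)"
      using chi_dilate_le[OF k, of "- \<xi>"] opposite by simp
    ultimately have "2 * chi (dilate k P)
        \<le> (\<Sum>B\<in>\<B>. ((k - a B + ?n) choose ?n) + ((k - (?n - a B) + ?n) choose ?n))"
      by (simp add: sum.distrib)
    then have "real (2 * chi (dilate k P))
        \<le> real (\<Sum>B\<in>\<B>. ((k - a B + ?n) choose ?n) + ((k - (?n - a B) + ?n) choose ?n))"
      by (rule of_nat_mono)
    then have "fact ?n * (2 * real (chi (dilate k P)))
        \<le> fact ?n * (\<Sum>B\<in>\<B>. real (k - a B + ?n choose ?n) + real (k - (?n - a B) + ?n choose ?n))"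
      by (intro mult_left_mono) simp_all
    also have "\<dots> < (\<Sum>B\<in>\<B>. ?E)"
      unfolding sum_distrib_left
    proof (rule sum_strict_mono)
      show "\<B> \<noteq> {}"
        using unit_cones_cover by blast
    qed (use small a_le unit_cones_finite in auto)
    also have "\<dots> = real (card \<B>) * ?E"
      by simp
    finally have "2 * real (chi (dilate k P)) < real (card \<B>) / fact ?n * ?E"
      by (simp add: field_simps)
    also have "\<dots> \<le> measure lebesgue P * ?E"
      by (intro mult_right_mono card_unit_cones_le_volume) auto
    also have "?E = 2 * (real k ^ ?n * (1 + (real ?n + 1) / (2 * real k)))"
      using \<open>0 < k\<close> by (simp add: field_simps)
    finally show "real (chi (dilate k P)) < real k ^ ?n * measure lebesgue P * (1 + (real ?n + 1) / (2 * real k))"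
      by (simp add: mult_ac)
  qed
qed

end

section \<open>Radial profiles and their moments\<close>

text \<open>The profiles of the trapezoidal rule. Heights \<open>t\<close> are measured relative to shell \<open>j\<close>, which has
  height \<open>1\<close>. On the layer between the shells \<open>j - 1\<close> and \<open>j\<close> the numerator interpolates linearly from
  \<open>0\<close> to \<open>1\<close>; \<open>fall\<close> does the opposite on the layer between \<open>j\<close> and \<open>j + 1\<close>. The power of \<open>t\<close>
  cancels against the density \<open>t\<^sup>n\<close> of a linear function on a cone.\<close>

definition rise :: "nat \<Rightarrow> nat \<Rightarrow> real \<Rightarrow> real" where
  "rise n j t = (if (real j - 1) / real j \<le> t \<and> t \<le> 1 then (real j * t - real j + 1) / t ^ n else 0)"

definition fall :: "nat \<Rightarrow> nat \<Rightarrow> real \<Rightarrow> real" where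
  "fall n j t = (if 1 \<le> t \<and> t \<le> (real j + 1) / real j then (real j + 1 - real j * t) / t ^ n else 0)"

definition cap :: "real \<Rightarrow> real" where
  "cap t = (if t \<le> 1 then 1 else 0)"

lemma borel_measurable_profiles [measurable]:
  "rise n j \<in> borel_measurable borel" "fall n j \<in> borel_measurable borel" "cap \<in> borel_measurable borel"
  unfolding rise_def fall_def cap_def by measurable

lemma rise_nonneg: "1 \<le> j \<Longrightarrow> 0 \<le> rise n j t"
proof -
  assume j: "1 \<le> j"
  have "0 \<le> (real j * t - real j + 1) / t ^ n" if "(real j - 1) / real j \<le> t"
  proof -
    have "0 \<le> (real j - 1) / real j"
      using j by simp
    then have "0 \<le> t"
      using that by linarith
    moreover have "real j - 1 \<le> real j * t"
      using that j by (simp add: field_simps)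
    ultimately show ?thesis
      by simp
  qed
  then show ?thesis
    by (simp add: rise_def)
qed

lemma fall_nonneg: "1 \<le> j \<Longrightarrow> 0 \<le> fall n j t"
  by (auto simp: fall_def field_simps)

lemma cap_nonneg: "0 \<le> cap t"
  by (simp add: cap_def)

lemma nn_integral_rise:
  assumes "1 \<le> j" "0 < n"
  shows "(\<integral>\<^sup>+t. ennreal (t ^ n / fact n) * ennreal (rise n j t) * indicator {0..} t \<partial>lborel)
    = ennreal (1 / (2 * real j * fact n))"
proof -
  let ?a = "(real j - 1) / real j"
  let ?F = "\<lambda>t. (real j * t - real j + 1) ^ 2 / (2 * real j * fact n)"
  have a: "0 \<le> ?a" "?a \<le> 1"
    using assms by (auto simp: divide_simps)
  have "(\<integral>\<^sup>+t. ennreal (t ^ n / fact n) * ennreal (rise n j t) * indicator {0..} t \<partial>lborel)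
      = (\<integral>\<^sup>+t. ennreal ((real j * t - real j + 1) / fact n) * indicator {?a..1} t \<partial>lborel)"
  proof (intro nn_integral_cong)
    fix t :: real
    show "ennreal (t ^ n / fact n) * ennreal (rise n j t) * indicator {0..} t
      = ennreal ((real j * t - real j + 1) / fact n) * indicator {?a..1} t"
    proof (cases "?a \<le> t \<and> t \<le> 1")
      case True
      then have t: "0 \<le> t"
        using a by linarith
      show ?thesis
        \<comment> \<open>At \<open>t = 0\<close>, where \<open>rise\<close> takes the default value of a division by zero, both sides vanish.\<close>
      proof (cases "t = 0")
        case True
        have "?a = 0"
          using True \<open>?a \<le> t \<and> t \<le> 1\<close> a by linarith
        then have "real j = 1"
          using assms by simp
        with True assms(2) show ?thesis
          by simp
      next
        case False
        then have "t ^ n / fact n * rise n j t = (real j * t - real j + 1) / fact n"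
          using \<open>?a \<le> t \<and> t \<le> 1\<close> by (simp add: rise_def)
        then show ?thesis
          using t \<open>?a \<le> t \<and> t \<le> 1\<close> rise_nonneg[OF assms(1)] by (simp add: ennreal_mult[symmetric])
      qed
    qed (auto simp: rise_def indicator_def)
  qed
  also have "\<dots> = ennreal (?F 1 - ?F ?a)"
  proof (rule nn_integral_FTC_Icc)
    fix t assume t: "t \<in> {?a..1}"
    then show "0 \<le> (real j * t - real j + 1) / fact n"
      using assms by (auto simp: field_simps)
    show "(?F has_real_derivative (real j * t - real j + 1) / fact n) (at t)"
      using assms(1) by (auto intro!: derivative_eq_intros simp: field_simps)
  qed (use a in auto)
  also have "?F 1 - ?F ?a = 1 / (2 * real j * fact n)"
    using assms(1) by (simp add: field_simps)
  finally show ?thesis .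
qed

lemma nn_integral_fall:
  assumes "1 \<le> j"
  shows "(\<integral>\<^sup>+t. ennreal (t ^ n / fact n) * ennreal (fall n j t) * indicator {0..} t \<partial>lborel)
    = ennreal (1 / (2 * real j * fact n))"
proof -
  let ?b = "(real j + 1) / real j"
  let ?F = "\<lambda>t. - ((real j + 1 - real j * t) ^ 2 / (2 * real j * fact n))"
  have b: "1 \<le> ?b"
    using assms by (auto simp: divide_simps)
  have "(\<integral>\<^sup>+t. ennreal (t ^ n / fact n) * ennreal (fall n j t) * indicator {0..} t \<partial>lborel)
      = (\<integral>\<^sup>+t. ennreal ((real j + 1 - real j * t) / fact n) * indicator {1..?b} t \<partial>lborel)"
  proof (intro nn_integral_cong)
    fix t :: real
    show "ennreal (t ^ n / fact n) * ennreal (fall n j t) * indicator {0..} t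
      = ennreal ((real j + 1 - real j * t) / fact n) * indicator {1..?b} t"
    proof (cases "1 \<le> t \<and> t \<le> ?b")
      case True
      then have "t ^ n / fact n * fall n j t = (real j + 1 - real j * t) / fact n"
        by (simp add: fall_def)
      then show ?thesis
        using True fall_nonneg[OF assms] by (simp add: ennreal_mult[symmetric])
    qed (auto simp: fall_def indicator_def)
  qed
  also have "\<dots> = ennreal (?F ?b - ?F 1)"
  proof (rule nn_integral_FTC_Icc)
    fix t assume t: "t \<in> {1..?b}"
    then show "0 \<le> (real j + 1 - real j * t) / fact n"
      using assms by (auto simp: field_simps)
    show "(?F has_real_derivative (real j + 1 - real j * t) / fact n) (at t)"
      using assms(1) by (auto intro!: derivative_eq_intros simp: field_simps)
  qed (use b in auto)
  also have "?F ?b - ?F 1 = 1 / (2 * real j * fact n)"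
    using assms(1) by (simp add: field_simps)
  finally show ?thesis .
qed

lemma nn_integral_cap:
  "(\<integral>\<^sup>+t. ennreal (t ^ n / fact n) * ennreal (cap t) * indicator {0..} t \<partial>lborel) = ennreal (1 / fact (Suc n))"
proof -
  have "(\<integral>\<^sup>+t. ennreal (t ^ n / fact n) * ennreal (cap t) * indicator {0..} t \<partial>lborel)
      = (\<integral>\<^sup>+t. ennreal (t ^ n / fact n) * indicator {0..1} t \<partial>lborel)"
    by (intro nn_integral_cong) (auto simp: cap_def indicator_def)
  also have "\<dots> = ennreal (1 ^ Suc n / fact (Suc n) - 0 ^ Suc n / fact (Suc n))"
    by (rule nn_integral_FTC_Icc[OF _ DERIV_power_over_fact]) auto
  finally show ?thesis
    by simp
qed

lemma convex_on_power_nonneg: "convex_on {0..b::real} (\<lambda>s. s ^ m)"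
proof (induction m)
  case (Suc m)
  have "convex_on {0..b} (\<lambda>s. s * s ^ m)"
  proof (rule convex_on_mul)
    show "convex_on {0..b} (\<lambda>s. s)"
      by (auto simp: convex_on_def)
    show "mono_on {0..b} (\<lambda>s. s ^ m)" "mono_on {0..b} (\<lambda>s. s)"
      by (auto intro!: mono_onI power_mono)
  qed (use Suc in auto)
  then show ?case
    by simp
qed (auto simp: convex_on_def)

text \<open>A convex function that is nonnegative and vanishes at \<open>0\<close> is increasing, so its product with a
  power is convex.\<close>

lemma convex_weighted_interpolation:
  fixes g :: "real \<Rightarrow> real"
  assumes g: "convex_on {0..b} g" "g 0 = 0" "\<And>s. s \<in> {0..b} \<Longrightarrow> 0 \<le> g s"
    and j: "1 \<le> j" "j \<le> b" and t: "j - 1 \<le> t" "t \<le> j"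
  shows "t ^ m * g t \<le> (j - t) * ((j - 1) ^ m * g (j - 1)) + (t - j + 1) * (j ^ m * g j)"
proof -
  have mono: "mono_on {0..b} g"
  proof (rule mono_onI)
    fix r s assume rs: "r \<in> {0..b}" "s \<in> {0..b}" "r \<le> s"
    show "g r \<le> g s"
    proof (cases "s = 0")
      case False
      then have "g ((1 - r / s) *\<^sub>R 0 + (r / s) *\<^sub>R s) \<le> (1 - r / s) * g 0 + (r / s) * g s"
        using rs by (intro convex_onD[OF g(1)]) auto
      then have "g r \<le> (r / s) * g s"
        using False g(2) by simp
      also have "\<dots> \<le> 1 * g s"
        using rs False g(3)[OF rs(2)] by (intro mult_right_mono) auto
      finally show ?thesis
        by simp
    qed (use rs in auto)
  qed
  have conv: "convex_on {0..b} (\<lambda>s. s ^ m * g s)"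
    using g mono by (intro convex_on_mul convex_on_power_nonneg) (auto intro!: mono_onI power_mono)
  let ?h = "\<lambda>s. s ^ m * g s" and ?u = "t - j + 1"
  have "?h ((1 - ?u) *\<^sub>R (j - 1) + ?u *\<^sub>R j) \<le> (1 - ?u) * ?h (j - 1) + ?u * ?h j"
    using j t by (intro convex_onD[OF conv]) auto
  moreover have "(1 - ?u) *\<^sub>R (j - 1) + ?u *\<^sub>R j = t"
    by (simp add: algebra_simps)
  ultimately show ?thesis
    by (simp add: algebra_simps)
qed

lemma cone_fun_nonneg:
  assumes "\<And>i. 0 \<le> c i" "\<And>t. 0 \<le> \<phi> t"
  shows "0 \<le> cone_fun B c \<phi> x"
  unfolding cone_fun_def Let_def using assms
  by (auto simp: indicator_def orthant_def intro!: mult_nonneg_nonneg sum_nonneg)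

section \<open>Bounding a convex function by lattice shells\<close>

lemma finite_bounded_lattice:
  fixes K :: "(real^'n) set"
  assumes "bounded K"
  shows "finite (K \<inter> lattice)"
proof -
  obtain b where b: "\<And>x. x \<in> K \<Longrightarrow> norm x \<le> b"
    using assms by (auto simp: bounded_iff)
  let ?G = "\<Pi>\<^sub>E i\<in>(UNIV :: 'n set). {- \<lceil>b\<rceil>..\<lceil>b\<rceil>}"
  have "K \<inter> lattice \<subseteq> (\<lambda>g. \<chi> i. of_int (g i)) ` ?G"
  proof
    fix x assume x: "x \<in> K \<inter> lattice"
    have "\<forall>i. \<exists>z::int. x $ i = of_int z"
      using x by (auto simp: lattice_def elim: Ints_cases)
    then obtain g where g: "\<And>i. x $ i = of_int (g i)"
      by metis
    have "g i \<in> {- \<lceil>b\<rceil>..\<lceil>b\<rceil>}" for i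
    proof -
      have "\<bar>real_of_int (g i)\<bar> \<le> b"
        using component_le_norm_cart[of x i] b[of x] x by (simp add: g)
      then show ?thesis
        by (simp add: abs_le_iff) linarith
    qed
    then show "x \<in> (\<lambda>g. \<chi> i. of_int (g i)) ` ?G"
      by (intro image_eqI[where x = g]) (auto simp: vec_eq_iff g)
  qed
  moreover have "finite ?G"
    by (intro finite_PiE) auto
  ultimately show ?thesis
    using finite_surj by blast
qed

definition shell_sum :: "(real^'n) set \<Rightarrow> (real^'n \<Rightarrow> real) \<Rightarrow> nat \<Rightarrow> real" where
  "shell_sum P f j = (\<Sum>p \<in> frontier (dilate j P) \<inter> lattice. f p)"

text \<open>The piecewise linear interpolation of \<open>f\<close> on the cones of a triangulation, weighted by a radial
  profile. Cones sharing a face are counted separately there, which only increases the function when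
  \<open>f\<close> is nonnegative at the vertices.\<close>

definition cone_envelope :: "(real^'n^'n) set \<Rightarrow> (real^'n \<Rightarrow> real) \<Rightarrow> (real \<Rightarrow> real) \<Rightarrow> real^'n \<Rightarrow> real" where
  "cone_envelope \<B> f \<phi> x = (\<Sum>B\<in>\<B>. cone_fun B (\<lambda>i. f (B *v axis i 1)) \<phi> x)"

lemma borel_measurable_cone_envelope [measurable]:
  "\<phi> \<in> borel_measurable borel \<Longrightarrow> cone_envelope \<B> f \<phi> \<in> borel_measurable borel"
  unfolding cone_envelope_def by measurable

lemma axis_in_face_simplex: "axis i 1 \<in> face_simplex"
  unfolding face_simplex_eq_hull by (simp add: hull_inc)

lemma axis_in_lattice: "axis i 1 \<in> lattice"
  by (simp add: lattice_def axis_def)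

text \<open>The bookkeeping between the height \<open>t\<close> relative to \<open>P\<close> and the height \<open>t / c\<close> relative to
  shell \<open>c\<close>.\<close>

lemma rescaled_profile:
  fixes t c :: real
  assumes "0 < t" "0 < c"
  shows "t ^ m * (w / (t / c) ^ Suc m * (t / c * g)) = w * (c ^ m * g)"
proof -
  have "w / (t / c) ^ Suc m * (t / c * g) = w * g / (t / c) ^ m"
    using assms by simp
  also have "\<dots> = w * g * c ^ m / t ^ m"
    by (simp add: power_divide)
  finally show ?thesis
    using assms by simp
qed

text \<open>The situation after an affine support function at the origin has been subtracted.\<close>

locale normalized_convex =
  fixes P :: "(real^'n) set" and \<B> :: "nat \<Rightarrow> (real^'n^'n) set"
    and f :: "real^'n \<Rightarrow> real" and k :: nat
  assumes P: "convex P" "compact P" "0 \<in> interior P"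
    and cones: "\<And>j. 0 < j \<Longrightarrow> boundary_cones j P (\<B> j)"
    and k_pos: "1 \<le> k"
    and f_convex: "convex_on (dilate k P) f"
    and f_zero: "f 0 = 0"
    and f_nonneg: "\<And>x. x \<in> dilate k P \<Longrightarrow> 0 \<le> f x"
begin

lemma zero_in_P: "0 \<in> P"
  using P(3) interior_subset by blast

lemma P_closed: "closed P"
  using P(2) compact_imp_closed by blast

lemma scale_mem_dilate:
  assumes "y \<in> P" "0 \<le> t" "t \<le> real k"
  shows "t *\<^sub>R y \<in> dilate k P"
proof -
  have "(1 - t / real k) *\<^sub>R 0 + (t / real k) *\<^sub>R y \<in> P"
    using P(1) zero_in_P assms k_pos by (intro convexD) auto
  moreover have "t *\<^sub>R y = real k *\<^sub>R ((1 - t / real k) *\<^sub>R 0 + (t / real k) *\<^sub>R y)"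
    using k_pos by simp
  ultimately show ?thesis
    unfolding dilate_def by blast
qed

lemma frontier_P_subset: "frontier P \<subseteq> P"
  using P_closed by (simp add: frontier_subset_closed)

lemma shell_subset:
  assumes "1 \<le> j" "j \<le> k"
  shows "frontier (dilate j P) \<subseteq> dilate k P"
proof
  fix x assume "x \<in> frontier (dilate j P)"
  then obtain y where "y \<in> frontier P" "x = real j *\<^sub>R y"
    using assms(1) frontier_dilate[of j P] by (auto simp: dilate_def)
  then show "x \<in> dilate k P"
    using frontier_P_subset assms by (auto intro: scale_mem_dilate)
qed

lemma bounded_dilate: "bounded (dilate j P)"
  unfolding dilate_def using P(2) by (intro bounded_scaling compact_imp_bounded)

lemma finite_shell: "1 \<le> j \<Longrightarrow> finite (frontier (dilate j P) \<inter> lattice)"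
  using bounded_dilate[of j] bounded_closure by (intro finite_bounded_lattice) (auto simp: frontier_def intro: bounded_subset)

lemma cones_finite: "1 \<le> j \<Longrightarrow> finite (\<B> j)"
  and cones_frontier: "1 \<le> j \<Longrightarrow> frontier (dilate j P) = (\<Union>B\<in>\<B> j. (*v) B ` face_simplex)"
  and cones_integral: "1 \<le> j \<Longrightarrow> B \<in> \<B> j \<Longrightarrow> integral_matrix B"
  and cones_det: "1 \<le> j \<Longrightarrow> B \<in> \<B> j \<Longrightarrow> \<bar>det B\<bar> = real j"
  and cones_degree: "1 \<le> j \<Longrightarrow> p \<in> frontier (dilate j P) \<Longrightarrow> card {B \<in> \<B> j. p \<in> (*v) B ` face_simplex} \<le> fact CARD('n)"
  using cones[of j] by (auto simp: boundary_cones_def)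

lemma cone_vertex:
  assumes "1 \<le> j" "B \<in> \<B> j"
  shows "B *v axis i 1 \<in> frontier (dilate j P) \<inter> lattice"
proof -
  have "B *v axis i 1 \<in> (*v) B ` face_simplex"
    using axis_in_face_simplex by (rule imageI)
  then have "B *v axis i 1 \<in> frontier (dilate j P)"
    unfolding cones_frontier[OF assms(1)] using assms(2) by blast
  moreover have "B *v axis i 1 \<in> lattice"
    using cones_integral[OF assms] axis_in_lattice by (rule integral_matrix_vector_mult)
  ultimately show ?thesis ..
qed

lemma cone_vertex_nonneg:
  assumes "1 \<le> j" "j \<le> k" "B \<in> \<B> j"
  shows "0 \<le> f (B *v axis i 1)"
  using cone_vertex[OF assms(1,3)] shell_subset[OF assms(1,2)] f_nonneg by blast

lemma shell_term_nonneg: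
  assumes "1 \<le> j" "j \<le> k" "p \<in> frontier (dilate j P) \<inter> lattice"
  shows "0 \<le> f p"
  using assms shell_subset f_nonneg by blast

lemma shell_sum_nonneg:
  assumes "1 \<le> j" "j \<le> k"
  shows "0 \<le> shell_sum P f j"
  unfolding shell_sum_def using shell_term_nonneg[OF assms] by (rule sum_nonneg)

text \<open>Exchanging the sums, every lattice point of the shell is counted once for each simplex of which it
  is a vertex, so at most \<open>n!\<close> times.\<close>

lemma sum_cone_vertices_le:
  assumes j: "1 \<le> j" "j \<le> k"
  shows "(\<Sum>B\<in>\<B> j. \<Sum>i\<in>UNIV. f (B *v axis i 1)) \<le> fact CARD('n) * shell_sum P f j"
proof -
  let ?L = "frontier (dilate j P) \<inter> lattice"
  let ?T = "\<lambda>B. (*v) B ` face_simplex"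
  have fin: "finite ?L"
    using finite_shell[OF j(1)] .
  have "(\<Sum>B\<in>\<B> j. \<Sum>i\<in>UNIV. f (B *v axis i 1)) \<le> (\<Sum>B\<in>\<B> j. \<Sum>p\<in>?L. of_bool (p \<in> ?T B) * f p)"
  proof (rule sum_mono)
    fix B assume B: "B \<in> \<B> j"
    have "det B \<noteq> 0"
      using cones_det[OF j(1) B] j(1) by auto
    then have "inj ((*v) B)"
      by (metis injI matrix_inv_vector_cancel(1))
    then have "inj (\<lambda>i. B *v axis i 1)"
      unfolding inj_def by (metis axis_eq_axis zero_neq_one)
    then have "(\<Sum>i\<in>UNIV. f (B *v axis i 1)) = (\<Sum>p\<in>range (\<lambda>i. B *v axis i 1). f p)"
      by (simp add: sum.reindex)
    also have "\<dots> \<le> (\<Sum>p\<in>{p \<in> ?L. p \<in> ?T B}. f p)"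
    proof (rule sum_mono2)
      show "range (\<lambda>i. B *v axis i 1) \<subseteq> {p \<in> ?L. p \<in> ?T B}"
        using cone_vertex[OF j(1) B] axis_in_face_simplex by blast
      show "finite {p \<in> ?L. p \<in> ?T B}"
        by (rule finite_subset[OF _ fin]) auto
    qed (use shell_term_nonneg[OF j] in auto)
    also have "\<dots> = (\<Sum>p\<in>?L. of_bool (p \<in> ?T B) * f p)"
      unfolding sum.inter_filter[OF fin] by (intro sum.cong) auto
    finally show "(\<Sum>i\<in>UNIV. f (B *v axis i 1)) \<le> (\<Sum>p\<in>?L. of_bool (p \<in> ?T B) * f p)" .
  qed
  also have "\<dots> = (\<Sum>p\<in>?L. \<Sum>B\<in>\<B> j. of_bool (p \<in> ?T B) * f p)"
    by (rule sum.swap)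
  also have "\<dots> = (\<Sum>p\<in>?L. real (card {B \<in> \<B> j. p \<in> ?T B}) * f p)"
    using cones_finite[OF j(1)] by (simp add: sum_distrib_right[symmetric] sum_of_bool_eq Int_def)
  also have "\<dots> \<le> (\<Sum>p\<in>?L. fact CARD('n) * f p)"
  proof (rule sum_mono)
    fix p assume p: "p \<in> ?L"
    have "real (card {B \<in> \<B> j. p \<in> ?T B}) \<le> real (fact CARD('n))"
      using cones_degree[OF j(1), of p] p by (intro of_nat_mono) auto
    then show "real (card {B \<in> \<B> j. p \<in> ?T B}) * f p \<le> fact CARD('n) * f p"
      using shell_term_nonneg[OF j p] by (intro mult_right_mono) auto
  qed
  finally show ?thesis
    by (simp add: shell_sum_def sum_distrib_left)
qed

lemma cone_envelope_nonneg:
  assumes "1 \<le> j" "j \<le> k" "\<And>t. 0 \<le> \<phi> t"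
  shows "0 \<le> cone_envelope (\<B> j) f \<phi> x"
  unfolding cone_envelope_def using assms cone_vertex_nonneg
  by (intro sum_nonneg cone_fun_nonneg) auto

text \<open>The factor \<open>n!\<close> from the degree bound cancels the one in the moment \<open>I\<close> of the profile.\<close>

lemma nn_integral_cone_envelope_le:
  assumes j: "1 \<le> j" "j \<le> k" and \<phi>: "\<And>t. 0 \<le> \<phi> t" and [measurable]: "\<phi> \<in> borel_measurable borel"
    and I: "(\<integral>\<^sup>+t. ennreal (t ^ CARD('n) / fact CARD('n)) * ennreal (\<phi> t) * indicator {0..} t \<partial>lborel) = ennreal I" "0 \<le> I"
  shows "(\<integral>\<^sup>+x. ennreal (cone_envelope (\<B> j) f \<phi> x) \<partial>lborel) \<le> ennreal (real j * fact CARD('n) * I * shell_sum P f j)"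
proof -
  let ?c = "\<lambda>B. \<Sum>i\<in>UNIV. f (B *v axis i 1)"
  have c: "0 \<le> ?c B" if "B \<in> \<B> j" for B
    using cone_vertex_nonneg[OF j that] by (intro sum_nonneg)
  have "(\<integral>\<^sup>+x. ennreal (cone_envelope (\<B> j) f \<phi> x) \<partial>lborel)
      = (\<integral>\<^sup>+x. (\<Sum>B\<in>\<B> j. ennreal (cone_fun B (\<lambda>i. f (B *v axis i 1)) \<phi> x)) \<partial>lborel)"
    unfolding cone_envelope_def
    using cone_fun_nonneg[OF cone_vertex_nonneg[OF j] \<phi>] by (subst sum_ennreal) auto
  also have "\<dots> = (\<Sum>B\<in>\<B> j. \<integral>\<^sup>+x. ennreal (cone_fun B (\<lambda>i. f (B *v axis i 1)) \<phi> x) \<partial>lborel)"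
    by (rule nn_integral_sum) measurable
  also have "\<dots> = (\<Sum>B\<in>\<B> j. ennreal (real j * ?c B * I))"
  proof (rule sum.cong[OF refl])
    fix B assume B: "B \<in> \<B> j"
    have "det B \<noteq> 0"
      using cones_det[OF j(1) B] j(1) by auto
    then show "(\<integral>\<^sup>+x. ennreal (cone_fun B (\<lambda>i. f (B *v axis i 1)) \<phi> x) \<partial>lborel) = ennreal (real j * ?c B * I)"
      using cone_vertex_nonneg[OF j B] \<phi> I(2) c[OF B]
      by (subst nn_integral_cone_fun) (auto simp: I(1) cones_det[OF j(1) B] ennreal_mult)
  qed
  also have "\<dots> = ennreal (real j * I * (\<Sum>B\<in>\<B> j. ?c B))"
  proof -
    have "(\<Sum>B\<in>\<B> j. ennreal (real j * ?c B * I)) = ennreal (\<Sum>B\<in>\<B> j. real j * ?c B * I)"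
      using c I(2) by (intro sum_ennreal mult_nonneg_nonneg) auto
    also have "(\<Sum>B\<in>\<B> j. real j * ?c B * I) = real j * I * (\<Sum>B\<in>\<B> j. ?c B)"
      unfolding sum_distrib_left[of "real j * I" ?c] by (intro sum.cong) (simp_all only: mult_ac)
    finally show ?thesis .
  qed
  also have "\<dots> \<le> ennreal (real j * I * (fact CARD('n) * shell_sum P f j))"
    using sum_cone_vertices_le[OF j] I(2) by (intro ennreal_leI mult_left_mono) auto
  finally show ?thesis
    by (simp add: mult_ac)
qed

lemma convex_bound_on_face:
  assumes j: "1 \<le> j" "j \<le> k" and B: "B \<in> \<B> j" and l: "l \<in> face_simplex"
  shows "f (B *v l) \<le> (\<Sum>i\<in>UNIV. f (B *v axis i 1) * l $ i)"
proof -
  have "B *v l = (\<Sum>i\<in>UNIV. l $ i *\<^sub>R (B *v axis i 1))"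
    by (simp add: matrix_mult_sum[of B l] matrix_vector_mult_basis scalar_mult_eq_scaleR)
  also have "f \<dots> \<le> (\<Sum>i\<in>UNIV. l $ i * f (B *v axis i 1))"
    using l cone_vertex[OF j(1) B] shell_subset[OF j]
    by (intro convex_on_sum[OF _ _ f_convex]) (auto simp: face_simplex_def orthant_def coord_sum_def)
  finally show ?thesis
    by (simp add: mult.commute)
qed

text \<open>Convexity on the simplex containing \<open>y\<close>, extended linearly along the ray through \<open>y\<close>.\<close>

lemma cone_envelope_ge:
  assumes j: "1 \<le> j" "j \<le> k" and \<phi>: "\<And>t. 0 \<le> \<phi> t" and y: "y \<in> frontier (dilate j P)" and t: "0 \<le> t"
  shows "\<phi> t * (t * f y) \<le> cone_envelope (\<B> j) f \<phi> (t *\<^sub>R y)"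
proof -
  obtain B l where B: "B \<in> \<B> j" "l \<in> face_simplex" "y = B *v l"
    using y cones_frontier[OF j(1)] by auto
  let ?c = "\<lambda>B i. f (B *v axis i 1)"
  have det: "det B \<noteq> 0"
    using cones_det[OF j(1) B(1)] j(1) by auto
  have "\<phi> t * (t * f y) \<le> \<phi> t * (t * (\<Sum>i\<in>UNIV. ?c B i * l $ i))"
    using convex_bound_on_face[OF j B(1,2)] \<phi> t B(3) by (intro mult_left_mono) auto
  also have "\<dots> = cone_fun B (?c B) \<phi> (B *v (t *\<^sub>R l))"
  proof -
    have "t *\<^sub>R l \<in> orthant" "coord_sum (t *\<^sub>R l) = t"
      using B(2) t by (auto simp: face_simplex_def orthant_def coord_sum_scaleR)
    then show ?thesis
      by (simp add: cone_fun_matrix_vector_mult[OF det] sum_distrib_left mult_ac)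
  qed
  also have "B *v (t *\<^sub>R l) = t *\<^sub>R y"
    by (simp add: B(3) matrix_vector_mult_scaleR)
  also have "cone_fun B (?c B) \<phi> (t *\<^sub>R y) \<le> cone_envelope (\<B> j) f \<phi> (t *\<^sub>R y)"
    unfolding cone_envelope_def using B(1) cones_finite[OF j(1)] cone_vertex_nonneg[OF j] \<phi>
    by (intro member_le_sum[where f = "\<lambda>B. cone_fun B (?c B) \<phi> (t *\<^sub>R y)"] cone_fun_nonneg) auto
  finally show ?thesis .
qed

lemma dilate_polar:
  assumes "x \<in> dilate k P" "x \<noteq> 0"
  obtains t y where "0 < t" "t \<le> real k" "y \<in> frontier P" "x = t *\<^sub>R y"
proof -
  obtain t y where ty: "0 < t" "y \<in> frontier P" "x = t *\<^sub>R y"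
    using on_ray_through_frontier[OF compact_imp_bounded[OF P(2)] P(3) assms(2)] .
  obtain z where "z \<in> P" "x = real k *\<^sub>R z"
    using assms(1) by (auto simp: dilate_def)
  then have "t \<le> real k"
    using frontier_scale_le[OF P(1,3) ty(2), of z "real k" t] ty(3) by simp
  with ty show thesis
    by (intro that)
qed

lemma scaled_frontier: "1 \<le> j \<Longrightarrow> y \<in> frontier P \<Longrightarrow> real j *\<^sub>R y \<in> frontier (dilate j P)"
  by (simp add: frontier_dilate[of j P]) (simp add: dilate_def)

lemma f_on_ray:
  assumes y: "y \<in> frontier P"
  shows "convex_on {0..real k} (\<lambda>s. f (s *\<^sub>R y))"
proof -
  have mem: "s *\<^sub>R y \<in> dilate k P" if "s \<in> {0..real k}" for s
    using that y frontier_P_subset by (auto intro: scale_mem_dilate)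
  show ?thesis
    unfolding convex_on_def
  proof (intro conjI ballI allI impI)
    fix r s u v :: real
    assume rs: "r \<in> {0..real k}" "s \<in> {0..real k}" and uv: "0 \<le> u" "0 \<le> v" "u + v = 1"
    have "f (u *\<^sub>R (r *\<^sub>R y) + v *\<^sub>R (s *\<^sub>R y)) \<le> u * f (r *\<^sub>R y) + v * f (s *\<^sub>R y)"
      using f_convex mem[OF rs(1)] mem[OF rs(2)] uv unfolding convex_on_def by blast
    then show "f ((u *\<^sub>R r + v *\<^sub>R s) *\<^sub>R y) \<le> u * f (r *\<^sub>R y) + v * f (s *\<^sub>R y)"
      by (simp add: scaleR_add_left)
  qed simp
qed

lemma f_le_cap_envelope:
  assumes x: "x \<in> dilate k P"
  shows "f x \<le> cone_envelope (\<B> k) f cap x"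
proof (cases "x = 0")
  case True
  then show ?thesis
    using cone_envelope_nonneg[OF k_pos order_refl cap_nonneg] by (simp add: f_zero)
next
  case False
  then obtain t y where t: "0 < t" "t \<le> real k" "y \<in> frontier P" "x = t *\<^sub>R y"
    using dilate_polar[OF x] by blast
  let ?r = "t / real k"
  have r: "0 \<le> ?r" "?r \<le> 1"
    using t k_pos by auto
  have "f ((1 - ?r) *\<^sub>R 0 + ?r *\<^sub>R (real k *\<^sub>R y)) \<le> (1 - ?r) * f 0 + ?r * f (real k *\<^sub>R y)"
    using r scale_mem_dilate[of 0 0] scale_mem_dilate[of y "real k"] t(3) frontier_P_subset zero_in_P
    by (intro convex_onD[OF f_convex]) auto
  then have "f x \<le> cap ?r * (?r * f (real k *\<^sub>R y))"
    using k_pos r by (simp add: f_zero t(4) cap_def)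
  also have "\<dots> \<le> cone_envelope (\<B> k) f cap (?r *\<^sub>R (real k *\<^sub>R y))"
    using k_pos t(3) r(1) by (intro cone_envelope_ge scaled_frontier cap_nonneg) auto
  finally show ?thesis
    using k_pos by (simp add: t(4))
qed

lemma f_le_shell_sum:
  assumes x: "x \<in> dilate k P"
  shows "f x \<le> shell_sum P f k"
proof (cases "x = 0")
  case True
  then show ?thesis
    using shell_sum_nonneg[OF k_pos order_refl] by (simp add: f_zero)
next
  case False
  then obtain t y where t: "0 < t" "t \<le> real k" "y \<in> frontier P" "x = t *\<^sub>R y"
    using dilate_polar[OF x] by blast
  obtain B l where B: "B \<in> \<B> k" "l \<in> face_simplex" "real k *\<^sub>R y = B *v l"
    using scaled_frontier[OF k_pos t(3)] cones_frontier[OF k_pos] by auto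
  let ?r = "t / real k"
  have r: "0 \<le> ?r" "?r \<le> 1"
    using t k_pos by auto
  have vertex: "f (B *v axis i 1) \<le> shell_sum P f k" for i
    unfolding shell_sum_def using cone_vertex[OF k_pos B(1)] finite_shell[OF k_pos] shell_term_nonneg[OF k_pos order_refl]
    by (intro member_le_sum) auto
  have "f ((1 - ?r) *\<^sub>R 0 + ?r *\<^sub>R (real k *\<^sub>R y)) \<le> (1 - ?r) * f 0 + ?r * f (real k *\<^sub>R y)"
    using r scale_mem_dilate[of 0 0] scale_mem_dilate[of y "real k"] t(3) frontier_P_subset zero_in_P
    by (intro convex_onD[OF f_convex]) auto
  then have "f x \<le> ?r * f (B *v l)"
    using k_pos by (simp add: f_zero t(4) B(3)[symmetric])
  also have "\<dots> \<le> 1 * (\<Sum>i\<in>UNIV. f (B *v axis i 1) * l $ i)"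
  proof (rule mult_mono)
    show "0 \<le> f (B *v l)"
      using f_nonneg scale_mem_dilate[of y "real k"] t(3) frontier_P_subset B(3) by auto
  qed (use r convex_bound_on_face[OF k_pos order_refl B(1,2)] in auto)
  also have "\<dots> \<le> 1 * (\<Sum>i\<in>UNIV. shell_sum P f k * l $ i)"
    using vertex B(2) by (intro mult_left_mono sum_mono mult_right_mono) (auto simp: face_simplex_def orthant_def)
  also have "\<dots> = shell_sum P f k"
    using B(2) by (simp add: sum_distrib_left[symmetric] face_simplex_def coord_sum_def)
  finally show ?thesis .
qed

text \<open>For each shell the two profiles add up to the hat function of the trapezoidal rule; the last shell
  has only the inner half of it, which is where the gain of half a shell comes from.\<close>

definition hat_envelope :: "real^'n \<Rightarrow> real" where
  "hat_envelope x = (\<Sum>j=1..k. cone_envelope (\<B> j) f (rise CARD('n) j) x)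
    + (\<Sum>j=1..<k. cone_envelope (\<B> j) f (fall CARD('n) j) x)"

text \<open>On the ray through a frontier point, \<open>f\<close> between two consecutive shells is estimated by the
  weighted interpolation of its values on these shells, and each value by the envelope of its
  shell.\<close>

lemma f_le_hat_envelope:
  assumes x: "x \<in> dilate k P"
  shows "f x \<le> hat_envelope x"
proof (cases "x = 0")
  case True
  then show ?thesis
    unfolding hat_envelope_def
    by (auto simp: f_zero intro!: add_nonneg_nonneg sum_nonneg cone_envelope_nonneg rise_nonneg fall_nonneg)
next
  case False
  then obtain t y where t: "0 < t" "t \<le> real k" "y \<in> frontier P" "x = t *\<^sub>R y"
    using dilate_polar[OF x] by blast
  define j where "j = nat \<lceil>t\<rceil>"
  have j: "1 \<le> j" "j \<le> k" "real j - 1 \<le> t" "t \<le> real j"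
    using t(1,2) unfolding j_def by linarith+
  obtain m where m: "CARD('n) = Suc m"
    using zero_less_card_finite[where 'a='n] gr0_implies_Suc by blast
  let ?n = "CARD('n)"
  let ?g = "\<lambda>s. f (s *\<^sub>R y)"
  have interp: "t ^ m * ?g t \<le> (real j - t) * ((real j - 1) ^ m * ?g (real j - 1)) + (t - real j + 1) * (real j ^ m * ?g (real j))"
  proof (rule convex_weighted_interpolation[OF f_on_ray[OF t(3)]])
    show "0 \<le> ?g s" if "s \<in> {0..real k}" for s
      using that t(3) frontier_P_subset by (auto intro!: f_nonneg scale_mem_dilate)
  qed (use j in \<open>auto simp: f_zero\<close>)
  let ?R = "cone_envelope (\<B> j) f (rise ?n j) x"
  have R: "(t - real j + 1) * (real j ^ m * ?g (real j)) \<le> t ^ m * ?R"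
  proof -
    let ?r = "t / real j"
    have "rise ?n j ?r = (t - real j + 1) / ?r ^ ?n"
      using j by (auto simp: rise_def divide_right_mono)
    then have eq: "t ^ m * (rise ?n j ?r * (?r * ?g (real j))) = (t - real j + 1) * (real j ^ m * ?g (real j))"
      using rescaled_profile[of t "real j" m] t(1) j(1) by (simp add: m del: power_Suc)
    have "rise ?n j ?r * (?r * ?g (real j)) \<le> cone_envelope (\<B> j) f (rise ?n j) (?r *\<^sub>R (real j *\<^sub>R y))"
      using j t(1,3) by (intro cone_envelope_ge scaled_frontier rise_nonneg) auto
    also have "?r *\<^sub>R (real j *\<^sub>R y) = x"
      using j(1) by (simp add: t(4))
    finally have "t ^ m * (rise ?n j ?r * (?r * ?g (real j))) \<le> t ^ m * ?R"
      using t(1) by (intro mult_left_mono) auto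
    then show ?thesis
      unfolding eq .
  qed
  have R_le: "?R \<le> (\<Sum>j=1..k. cone_envelope (\<B> j) f (rise ?n j) x)"
    using j by (intro member_le_sum[where f = "\<lambda>j. cone_envelope (\<B> j) f (rise ?n j) x"] cone_envelope_nonneg rise_nonneg) auto
  have F: "(real j - t) * ((real j - 1) ^ m * ?g (real j - 1))
      \<le> t ^ m * (\<Sum>j=1..<k. cone_envelope (\<B> j) f (fall ?n j) x)"
  proof (cases "j = 1")
    case True
    then show ?thesis
      using t(1) by (auto simp: f_zero intro!: mult_nonneg_nonneg sum_nonneg cone_envelope_nonneg fall_nonneg)
  next
    case False
    define i where "i = j - 1"
    have i: "1 \<le> i" "i < k" "real i = real j - 1"
      using False j by (auto simp: i_def)
    let ?r = "t / real i"
    have "1 \<le> ?r" "?r \<le> (real i + 1) / real i"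
      using i j by (auto simp: field_simps)
    then have "fall ?n i ?r = (real j - t) / ?r ^ ?n"
      using i by (auto simp: fall_def)
    then have "t ^ m * (fall ?n i ?r * (?r * ?g (real i))) = (real j - t) * (real i ^ m * ?g (real i))"
      using rescaled_profile[of t "real i" m] t(1) i(1) by (simp add: m del: power_Suc)
    moreover have "fall ?n i ?r * (?r * ?g (real i)) \<le> cone_envelope (\<B> i) f (fall ?n i) (?r *\<^sub>R (real i *\<^sub>R y))"
      using i t(1,3) by (intro cone_envelope_ge scaled_frontier fall_nonneg) auto
    moreover have "?r *\<^sub>R (real i *\<^sub>R y) = x"
      using i(1) by (simp add: t(4))
    moreover have "cone_envelope (\<B> i) f (fall ?n i) x \<le> (\<Sum>j=1..<k. cone_envelope (\<B> j) f (fall ?n j) x)"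
      using i by (intro member_le_sum[where f = "\<lambda>j. cone_envelope (\<B> j) f (fall ?n j) x"] cone_envelope_nonneg fall_nonneg) auto
    ultimately have "t ^ m * (fall ?n i ?r * (?r * ?g (real i))) \<le> t ^ m * (\<Sum>j=1..<k. cone_envelope (\<B> j) f (fall ?n j) x)"
      using t(1) by (intro mult_left_mono) auto
    then show ?thesis
      using \<open>t ^ m * (fall ?n i ?r * (?r * ?g (real i))) = _\<close> i(3) by simp
  qed
  have "t ^ m * f x \<le> t ^ m * (\<Sum>j=1..k. cone_envelope (\<B> j) f (rise ?n j) x)
      + t ^ m * (\<Sum>j=1..<k. cone_envelope (\<B> j) f (fall ?n j) x)"
  proof -
    have "t ^ m * ?R \<le> t ^ m * (\<Sum>j=1..k. cone_envelope (\<B> j) f (rise ?n j) x)"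
      using t(1) by (intro mult_left_mono[OF R_le]) simp
    from add_mono[OF F order_trans[OF R this]] order_trans[OF interp] show ?thesis
      unfolding t(4)[symmetric] by (subst add.commute) blast
  qed
  then have "t ^ m * f x \<le> t ^ m * hat_envelope x"
    by (simp add: hat_envelope_def distrib_left)
  then show ?thesis
    using t(1) by simp
qed

lemma nn_integral_cap_envelope_le:
  "(\<integral>\<^sup>+x. ennreal (cone_envelope (\<B> k) f cap x) \<partial>lborel) \<le> ennreal (real k / (real CARD('n) + 1) * shell_sum P f k)"
proof -
  have "(\<integral>\<^sup>+x. ennreal (cone_envelope (\<B> k) f cap x) \<partial>lborel)
      \<le> ennreal (real k * fact CARD('n) * (1 / fact (Suc CARD('n))) * shell_sum P f k)"
    by (rule nn_integral_cone_envelope_le[OF k_pos order_refl cap_nonneg _ nn_integral_cap]) auto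
  also have "real k * fact CARD('n) * (1 / fact (Suc CARD('n))) = real k / (real CARD('n) + 1)"
    by (simp add: add.commute)
  finally show ?thesis .
qed

lemma nn_integral_hat_envelope_le:
  "(\<integral>\<^sup>+x. ennreal (hat_envelope x) \<partial>lborel)
    \<le> ennreal ((\<Sum>j=1..k. shell_sum P f j / 2) + (\<Sum>j=1..<k. shell_sum P f j / 2))"
proof -
  let ?n = "CARD('n)"
  let ?R = "\<lambda>j x. cone_envelope (\<B> j) f (rise ?n j) x" and ?F = "\<lambda>j x. cone_envelope (\<B> j) f (fall ?n j) x"
  have R0: "0 \<le> ?R j x" if "j \<in> {1..k}" for j x
    using that by (intro cone_envelope_nonneg rise_nonneg) auto
  have F0: "0 \<le> ?F j x" if "j \<in> {1..<k}" for j x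
    using that by (intro cone_envelope_nonneg fall_nonneg) auto
  have "(\<integral>\<^sup>+x. ennreal (hat_envelope x) \<partial>lborel)
      = (\<integral>\<^sup>+x. (\<Sum>j=1..k. ennreal (?R j x)) + (\<Sum>j=1..<k. ennreal (?F j x)) \<partial>lborel)"
  proof (intro nn_integral_cong)
    fix x
    have "(\<Sum>j=1..k. ennreal (?R j x)) = ennreal (\<Sum>j=1..k. ?R j x)"
      "(\<Sum>j=1..<k. ennreal (?F j x)) = ennreal (\<Sum>j=1..<k. ?F j x)"
      using R0 F0 by (auto intro!: sum_ennreal)
    moreover have "0 \<le> (\<Sum>j=1..k. ?R j x)" "0 \<le> (\<Sum>j=1..<k. ?F j x)"
      using R0 F0 by (auto intro!: sum_nonneg)
    ultimately show "ennreal (hat_envelope x) = (\<Sum>j=1..k. ennreal (?R j x)) + (\<Sum>j=1..<k. ennreal (?F j x))"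
      by (simp add: hat_envelope_def ennreal_plus)
  qed
  also have "\<dots> = (\<Sum>j=1..k. \<integral>\<^sup>+x. ennreal (?R j x) \<partial>lborel) + (\<Sum>j=1..<k. \<integral>\<^sup>+x. ennreal (?F j x) \<partial>lborel)"
    by (subst nn_integral_add) (simp_all add: nn_integral_sum)
  also have "\<dots> \<le> (\<Sum>j=1..k. ennreal (shell_sum P f j / 2)) + (\<Sum>j=1..<k. ennreal (shell_sum P f j / 2))"
  proof (intro add_mono sum_mono)
    fix j assume j: "j \<in> {1..k}"
    have "(\<integral>\<^sup>+x. ennreal (?R j x) \<partial>lborel) \<le> ennreal (real j * fact ?n * (1 / (2 * real j * fact ?n)) * shell_sum P f j)"
      using j by (intro nn_integral_cone_envelope_le nn_integral_rise rise_nonneg) auto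
    then show "(\<integral>\<^sup>+x. ennreal (?R j x) \<partial>lborel) \<le> ennreal (shell_sum P f j / 2)"
      using j by simp
  next
    fix j assume j: "j \<in> {1..<k}"
    have "(\<integral>\<^sup>+x. ennreal (?F j x) \<partial>lborel) \<le> ennreal (real j * fact ?n * (1 / (2 * real j * fact ?n)) * shell_sum P f j)"
      using j by (intro nn_integral_cone_envelope_le nn_integral_fall fall_nonneg) auto
    then show "(\<integral>\<^sup>+x. ennreal (?F j x) \<partial>lborel) \<le> ennreal (shell_sum P f j / 2)"
      using j by simp
  qed
  also have "\<dots> = ennreal ((\<Sum>j=1..k. shell_sum P f j / 2) + (\<Sum>j=1..<k. shell_sum P f j / 2))"
  proof -
    have "(\<Sum>j=1..k. ennreal (shell_sum P f j / 2)) = ennreal (\<Sum>j=1..k. shell_sum P f j / 2)"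
      "(\<Sum>j=1..<k. ennreal (shell_sum P f j / 2)) = ennreal (\<Sum>j=1..<k. shell_sum P f j / 2)"
      using shell_sum_nonneg by (auto intro!: sum_ennreal)
    moreover have "0 \<le> (\<Sum>j=1..k. shell_sum P f j / 2)" "0 \<le> (\<Sum>j=1..<k. shell_sum P f j / 2)"
      using shell_sum_nonneg by (auto intro!: sum_nonneg)
    ultimately show ?thesis
      by (simp add: ennreal_plus)
  qed
  finally show ?thesis .
qed

end

section \<open>The inequality for a normalized convex function\<close>

text \<open>Separate the strict epigraph from the point \<open>(x0, f x0)\<close>. The separating hyperplane cannot be
  vertical because \<open>x0\<close> is an interior point.\<close>

lemma convex_on_affine_minorant:
  fixes f :: "'a::euclidean_space \<Rightarrow> real"
  assumes f: "convex_on S f" and x0: "x0 \<in> interior S"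
  obtains b where "\<And>x. x \<in> S \<Longrightarrow> f x0 + b \<bullet> (x - x0) \<le> f x"
proof -
  have x0S: "x0 \<in> S"
    using x0 interior_subset by blast
  define E where "E = {p. fst p \<in> S \<and> f (fst p) < snd p}"
  have "convex E"
    unfolding convex_def
  proof (intro ballI allI impI)
    fix p q and u v :: real
    assume pq: "p \<in> E" "q \<in> E" and uv: "0 \<le> u" "0 \<le> v" "u + v = 1"
    have S: "u *\<^sub>R fst p + v *\<^sub>R fst q \<in> S"
      using pq uv convex_on_imp_convex[OF f] unfolding E_def convex_def by blast
    have "f (u *\<^sub>R fst p + v *\<^sub>R fst q) \<le> u * f (fst p) + v * f (fst q)"
      using f pq uv unfolding convex_on_def E_def by blast
    also have "\<dots> < u * snd p + v * snd q"
    proof (cases "u = 0")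
      case True
      then show ?thesis
        using pq uv by (simp add: E_def)
    next
      case False
      then have "u * f (fst p) < u * snd p"
        using pq uv by (simp add: E_def)
      moreover have "v * f (fst q) \<le> v * snd q"
        using pq uv by (intro mult_left_mono) (auto simp: E_def)
      ultimately show ?thesis
        by linarith
    qed
    finally show "u *\<^sub>R p + v *\<^sub>R q \<in> E"
      using S by (simp add: E_def)
  qed
  moreover have "(x0, f x0 + 1) \<in> E"
    using x0S by (simp add: E_def)
  moreover have "E \<inter> {(x0, f x0)} = {}"
    by (simp add: E_def)
  ultimately have "\<exists>a \<beta>. a \<noteq> 0 \<and> (\<forall>p\<in>E. a \<bullet> p \<le> \<beta>) \<and> (\<forall>p\<in>{(x0, f x0)}. \<beta> \<le> a \<bullet> p)"
    by (intro separating_hyperplane_sets) auto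
  then obtain a \<beta> where a: "a \<noteq> 0" "\<forall>p\<in>E. a \<bullet> p \<le> \<beta>" "\<beta> \<le> a \<bullet> (x0, f x0)"
    by blast
  obtain w \<alpha> where w: "a = (w, \<alpha>)"
    by (cases a)
  have sep: "w \<bullet> (x - x0) + \<alpha> * (s - f x0) \<le> 0" if "x \<in> S" "f x < s" for x s
  proof -
    have "a \<bullet> (x, s) \<le> a \<bullet> (x0, f x0)"
      using a(2,3) that by (force simp: E_def)
    then show ?thesis
      by (simp add: w inner_diff_right algebra_simps)
  qed
  have "\<alpha> \<le> 0"
    using sep[OF x0S, of "f x0 + 1"] by simp
  moreover have "\<alpha> \<noteq> 0"
  proof
    assume "\<alpha> = 0"
    then have "w \<noteq> 0"
      using a(1) w by (auto simp: zero_prod_def)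
    obtain e where e: "e > 0" "ball x0 e \<subseteq> S"
      using x0 by (auto simp: mem_interior)
    \<comment> \<open>A point of \<open>S\<close> on the wrong side of the vertical hyperplane.\<close>
    let ?x = "x0 + (e / (2 * norm w)) *\<^sub>R w"
    have "?x \<in> ball x0 e"
      using e(1) \<open>w \<noteq> 0\<close> by (simp add: dist_norm)
    then have "w \<bullet> (?x - x0) \<le> 0"
      using sep[of ?x "f ?x + 1"] e(2) \<open>\<alpha> = 0\<close> by auto
    moreover have "0 < (e / (2 * norm w)) * (w \<bullet> w)"
      using e(1) \<open>w \<noteq> 0\<close> by simp
    ultimately show False
      by simp
  qed
  ultimately have \<alpha>: "\<alpha> < 0"
    by simp
  show thesis
  proof (rule that[of "(1 / - \<alpha>) *\<^sub>R w"])
    fix x assume x: "x \<in> S"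
    show "f x0 + (1 / - \<alpha>) *\<^sub>R w \<bullet> (x - x0) \<le> f x"
    proof (rule dense_ge)
      fix s assume "f x < s"
      then have "w \<bullet> (x - x0) \<le> - \<alpha> * (s - f x0)"
        using sep[OF x \<open>f x < s\<close>] by (simp add: algebra_simps)
      then have "(w \<bullet> (x - x0)) / - \<alpha> \<le> s - f x0"
        using \<alpha> by (subst pos_divide_le_eq) (auto simp: mult.commute)
      then show "f x0 + (1 / - \<alpha>) *\<^sub>R w \<bullet> (x - x0) \<le> s"
        by simp
    qed
  qed
qed

text \<open>A convex function is continuous in the interior and the frontier of a convex set is negligible, so
  jumps at the frontier do no harm.\<close>

lemma bounded_convex_absolutely_integrable:
  fixes f :: "'a::euclidean_space \<Rightarrow> real"
  assumes K: "compact K" and f: "convex_on K f" and bound: "\<And>x. x \<in> K \<Longrightarrow> \<bar>f x\<bar> \<le> M"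
  shows "f absolutely_integrable_on K"
proof -
  have conv: "convex K"
    using convex_on_imp_convex[OF f] .
  have int: "interior K \<in> lmeasurable"
    using K by (intro lmeasurable_open bounded_subset[OF compact_imp_bounded interior_subset]) auto
  have "convex_on (interior K) f"
    using convex_on_subset[OF f] interior_subset convex_interior[OF conv] by blast
  then have "continuous_on (interior K) f"
    by (rule convex_on_continuous[OF open_interior])
  then have "f absolutely_integrable_on interior K"
    using int bound interior_subset
    by (intro measurable_bounded_by_integrable_imp_absolutely_integrable[where g = "\<lambda>_. M"]
        continuous_imp_measurable_on_sets_lebesgue integrable_on_const) (auto dest: subsetD[OF interior_subset] simp: fmeasurableD)
  moreover have "negligible (frontier K)"
    by (rule negligible_convex_frontier[OF conv])
  then have "negligible {x \<in> K - interior K. f x \<noteq> 0}"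
    by (rule negligible_subset) (use closure_subset in \<open>auto simp: frontier_def\<close>)
  moreover have "negligible {x \<in> interior K - K. f x \<noteq> 0}"
    using interior_subset by (intro negligible_subset[OF negligible_empty]) auto
  ultimately show ?thesis
    using absolutely_integrable_spike_set_eq by blast
qed

lemma set_integral_le_of_nn_integral_bound:
  fixes f F :: "'a::euclidean_space \<Rightarrow> real"
  assumes f: "f absolutely_integrable_on K" and le: "\<And>x. x \<in> K \<Longrightarrow> 0 \<le> f x \<and> f x \<le> F x"
    and F: "(\<integral>\<^sup>+x. ennreal (F x) \<partial>lborel) \<le> ennreal c" and c: "0 \<le> c"
  shows "(LINT x:K|lebesgue. f x) \<le> c"
proof -
  have "ennreal (LINT x:K|lebesgue. f x) = (\<integral>\<^sup>+x. ennreal (indicator K x *\<^sub>R f x) \<partial>lebesgue)"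
    unfolding set_lebesgue_integral_def using f le
    by (intro nn_integral_eq_integral[symmetric]) (auto simp: set_integrable_def indicator_def)
  also have "\<dots> \<le> (\<integral>\<^sup>+x. ennreal (F x) \<partial>lebesgue)"
    using le by (intro nn_integral_mono) (auto simp: indicator_def intro!: ennreal_leI)
  also have "\<dots> = (\<integral>\<^sup>+x. ennreal (F x) \<partial>lborel)"
    by (rule nn_integral_completion)
  also have "\<dots> \<le> ennreal c"
    by (rule F)
  finally show ?thesis
    using c by simp
qed

lemma measure_dilate:
  fixes P :: "(real^'n) set"
  assumes "compact P"
  shows "measure lebesgue (dilate k P) = real k ^ CARD('n) * measure lebesgue P"
proof -
  have "dilate k P = (\<lambda>x. \<chi> i. real k * x $ i) ` P"
    unfolding dilate_def by (rule image_cong) (auto simp: vec_eq_iff)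
  then show ?thesis
    using measure_stretch[OF lmeasurable_compact[OF assms], of "\<lambda>_. real k"] by simp
qed

context normalized_convex
begin

lemma compact_dilate: "compact (dilate j P)"
  unfolding dilate_def using P(2) by (rule compact_scaling)

lemma f_integrable: "f absolutely_integrable_on dilate k P"
  using f_nonneg f_le_shell_sum
  by (intro bounded_convex_absolutely_integrable[OF compact_dilate f_convex, of "shell_sum P f k"]) auto

lemma integral_le_last_shell:
  "(LINT x:dilate k P|lebesgue. f x) \<le> real k / (real CARD('n) + 1) * shell_sum P f k"
  using f_nonneg f_le_cap_envelope shell_sum_nonneg[OF k_pos order_refl]
  by (intro set_integral_le_of_nn_integral_bound[OF f_integrable _ nn_integral_cap_envelope_le]) auto

lemma integral_le_trapezoid:
  "(LINT x:dilate k P|lebesgue. f x) \<le> (\<Sum>j=1..k. shell_sum P f j) - shell_sum P f k / 2"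
proof -
  have "(LINT x:dilate k P|lebesgue. f x) \<le> (\<Sum>j=1..k. shell_sum P f j / 2) + (\<Sum>j=1..<k. shell_sum P f j / 2)"
    using f_nonneg f_le_hat_envelope shell_sum_nonneg
    by (intro set_integral_le_of_nn_integral_bound[OF f_integrable _ nn_integral_hat_envelope_le])
      (auto intro!: add_nonneg_nonneg sum_nonneg)
  moreover have "(\<Sum>j=1..k. shell_sum P f j / 2) = (\<Sum>j=1..<k. shell_sum P f j / 2) + shell_sum P f k / 2"
    using k_pos by (simp add: sum.last_plus atLeastLessThanSuc_atLeastAtMost add.commute)
  moreover have "(\<Sum>j=1..k. shell_sum P f j / 2) = (\<Sum>j=1..k. shell_sum P f j) / 2"
    by (simp add: sum_divide_distrib)
  ultimately show ?thesis
    by linarith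
qed

text \<open>The frontiers of distinct dilates are disjoint.\<close>

lemma sum_shells_le:
  "(\<Sum>j=1..k. shell_sum P f j) \<le> (\<Sum>p \<in> dilate k P \<inter> lattice. f p)"
proof -
  let ?L = "\<lambda>j. frontier (dilate j P) \<inter> lattice"
  have disj: "?L i \<inter> ?L j = {}" if ij: "1 \<le> i" "1 \<le> j" "i \<noteq> j" for i j
  proof (rule ccontr)
    assume "?L i \<inter> ?L j \<noteq> {}"
    then obtain y z where yz: "y \<in> frontier P" "z \<in> frontier P" "real i *\<^sub>R y = real j *\<^sub>R z"
      using frontier_dilate[of i P] frontier_dilate[of j P] ij by (auto simp: dilate_def)
    have "y \<in> P" "z \<in> P"
      using yz frontier_P_subset by auto
    then have "real i \<le> real j" "real j \<le> real i"
      using frontier_scale_le[OF P(1,3) yz(1), of z "real j" "real i"]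
        frontier_scale_le[OF P(1,3) yz(2), of y "real i" "real j"] yz(3) by auto
    with ij(3) show False
      by simp
  qed
  have "(\<Sum>j=1..k. shell_sum P f j) = (\<Sum>p\<in>(\<Union>j\<in>{1..k}. ?L j). f p)"
    unfolding shell_sum_def using finite_shell disj
    by (intro sum.UNION_disjoint[symmetric]) auto
  also have "\<dots> \<le> (\<Sum>p \<in> dilate k P \<inter> lattice. f p)"
  proof (rule sum_mono2)
    show "finite (dilate k P \<inter> lattice)"
      by (rule finite_bounded_lattice[OF bounded_dilate])
    have "?L j \<subseteq> dilate k P \<inter> lattice" if "j \<in> {1..k}" for j
      using shell_subset[of j] that by auto
    then show "(\<Union>j\<in>{1..k}. ?L j) \<subseteq> dilate k P \<inter> lattice"
      by blast
  qed (use f_nonneg in auto)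
  finally show ?thesis .
qed

text \<open>Let \<open>X\<close> be the number of lattice points, \<open>V\<close> the volume of \<open>kP\<close> and \<open>S\<close> the sum over the last
  shell. The trapezoidal bound leaves a gain of \<open>S / 2\<close>, while replacing \<open>V\<close> by \<open>X\<close> costs
  \<open>(X / V - 1) \<integral> f\<close>, which the hypothesis and the bound \<open>\<integral> f \<le> k / (n + 1) S\<close> keep below
  \<open>S / 2\<close>. If \<open>S = 0\<close> then \<open>f\<close> vanishes, because it is at most \<open>S\<close> on \<open>kP\<close>.\<close>

theorem normalized_chow_inequality:
  assumes chi: "real (chi (dilate k P)) < real k ^ CARD('n) * measure lebesgue P * (1 + (real CARD('n) + 1) / (2 * real k))"
  shows "volume_mean (dilate k P) f \<le> lattice_mean (dilate k P) f"
    and "volume_mean (dilate k P) f = lattice_mean (dilate k P) f \<Longrightarrow> x \<in> dilate k P \<Longrightarrow> f x = 0"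
proof -
  let ?Q = "dilate k P" and ?n = "real CARD('n)" and ?S = "shell_sum P f k"
  define I where "I = (LINT x:?Q|lebesgue. f x)"
  define N where "N = (\<Sum>p \<in> ?Q \<inter> lattice. f p)"
  define V where "V = measure lebesgue ?Q"
  define X where "X = real (chi ?Q)"
  have chi': "X < V * (1 + (?n + 1) / (2 * real k))"
    using chi by (simp add: X_def V_def measure_dilate[OF P(2)])
  have "0 \<in> ?Q \<inter> lattice"
    using scale_mem_dilate[OF zero_in_P, of 0] by (simp add: lattice_def)
  then have X: "0 < X"
    unfolding X_def chi_def using finite_bounded_lattice[OF bounded_dilate] by (auto simp: card_gt_0_iff)
  have "0 < 1 + (?n + 1) / (2 * real k)"
    by (intro add_pos_nonneg) auto
  then have V: "0 < V"
    using X chi' by (smt (verit) mult_nonpos_nonneg)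
  have vm: "volume_mean ?Q f = I / V" and lm: "lattice_mean ?Q f = N / X"
    by (simp_all add: volume_mean_def lattice_mean_def I_def N_def V_def X_def)
  have zero: "f x = 0" if "?S = 0" "x \<in> ?Q" for x
    using f_le_shell_sum[OF that(2)] f_nonneg[OF that(2)] that(1) by simp
  have strict: "I / V < N / X" if S: "0 < ?S"
  proof -
    have "I \<le> N - ?S / 2"
      using integral_le_trapezoid sum_shells_le by (simp add: I_def N_def)
    have I: "0 \<le> I"
      unfolding I_def using f_nonneg by (auto simp: set_lebesgue_integral_def indicator_def intro!: Bochner_Integration.integral_nonneg)
    have "X / V - 1 < (?n + 1) / (2 * real k)"
      using chi' V by (simp add: field_simps)
    then have "(X / V - 1) * I \<le> (?n + 1) / (2 * real k) * I"
      using I by (intro mult_right_mono) auto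
    show ?thesis
    proof (cases "I = 0")
      case True
      then have "0 < N"
        using \<open>I \<le> N - ?S / 2\<close> S by linarith
      then show ?thesis
        using True X by simp
    next
      case False
      then have "(X / V - 1) * I < (?n + 1) / (2 * real k) * I"
        using I \<open>X / V - 1 < (?n + 1) / (2 * real k)\<close> by (intro mult_strict_right_mono) auto
      also have "\<dots> \<le> (?n + 1) / (2 * real k) * (real k / (?n + 1) * ?S)"
        using integral_le_last_shell by (intro mult_left_mono) (auto simp: I_def)
      also have "\<dots> = ?S / 2"
      proof -
        have "(?n + 1) / (2 * real k) * (real k / (?n + 1)) = 1 / 2"
          using k_pos by (simp add: divide_simps)
        then show ?thesis
          by (metis mult.assoc mult.commute mult_1 times_divide_eq_right)
      qed
      finally have "X / V * I < N"
        using \<open>I \<le> N - ?S / 2\<close> by (simp only: left_diff_distrib mult_1)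
      then show ?thesis
        using X V by (simp add: field_simps)
    qed
  qed
  have zero_means: "I / V = 0" "N / X = 0" if "?S = 0"
  proof -
    have "I = 0"
      unfolding I_def set_lebesgue_integral_def
      using zero[OF that] by (intro integral_eq_zero_AE AE_I2) (auto simp: indicator_def)
    then show "I / V = 0"
      by simp
    show "N / X = 0"
      unfolding N_def using zero[OF that] by simp
  qed
  have S: "?S = 0 \<or> 0 < ?S"
    using shell_sum_nonneg[OF k_pos order_refl] by linarith
  show "volume_mean ?Q f \<le> lattice_mean ?Q f"
    unfolding vm lm using S strict zero_means by fastforce
  show "f x = 0" if "volume_mean ?Q f = lattice_mean ?Q f" "x \<in> ?Q"
    using that S strict zero unfolding vm lm by fastforce
qed

end

section \<open>Reduction to the normalized case\<close>

lemma affine_fn_eq: "affine_fn c b x = c + b \<bullet> x"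
  by (simp add: affine_fn_def inner_vec_def)

lemma continuous_on_affine_fn: "continuous_on S (affine_fn c b)"
  unfolding affine_fn_eq by (intro continuous_intros)

lemma affine_fn_integrable:
  assumes "compact K"
  shows "affine_fn c b absolutely_integrable_on K"
proof -
  have "integrable lborel (\<lambda>x. indicator K x *\<^sub>R affine_fn c b x)"
    by (rule borel_integrable_compact[OF assms continuous_on_affine_fn])
  then show ?thesis
    unfolding set_integrable_def
    by (subst integrable_completion) (auto dest: borel_measurable_integrable)
qed

lemma set_integral_dilate:
  fixes P :: "(real^'n) set" and g :: "real^'n \<Rightarrow> real"
  assumes k: "0 < k" and P: "compact P" and g: "continuous_on UNIV g"
  shows "(LINT x:dilate k P|lebesgue. g x) = real k ^ CARD('n) * (LINT x:P|lebesgue. g (real k *\<^sub>R x))"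
proof -
  have meas: "(\<lambda>x. indicator K x *\<^sub>R h x) \<in> borel_measurable lborel" if "compact K" "continuous_on UNIV h"
    for K and h :: "real^'n \<Rightarrow> real"
    using that borel_measurable_continuous_onI[of h] by (auto dest: compact_imp_closed)
  have Q: "compact (dilate k P)"
    unfolding dilate_def using P by (rule compact_scaling)
  have ind: "indicator (dilate k P) (real k *\<^sub>R x) = (indicator P x :: real)" for x
    using k by (auto simp: dilate_def indicator_def)
  let ?F = "\<lambda>x. indicator (dilate k P) x *\<^sub>R g x"
  have "(LINT x:dilate k P|lebesgue. g x) = integral\<^sup>L lborel ?F"
    unfolding set_lebesgue_integral_def by (rule integral_completion[OF meas[OF Q g]])
  also have "\<dots> = integral\<^sup>L (density (distr lborel borel (\<lambda>x. 0 + real k *\<^sub>R x)) (\<lambda>_. \<bar>real k\<bar> ^ DIM(real^'n))) ?F"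
    using lborel_affine[of "real k" "0 :: real^'n"] k by simp
  also have "\<dots> = real k ^ CARD('n) * integral\<^sup>L lborel (\<lambda>x. ?F (real k *\<^sub>R x))"
    using meas[OF Q g] k
    by (subst integral_density) (auto simp: integral_distr)
  also have "integral\<^sup>L lborel (\<lambda>x. ?F (real k *\<^sub>R x)) = (LINT x:P|lebesgue. g (real k *\<^sub>R x))"
    unfolding set_lebesgue_integral_def ind
    by (rule integral_completion[OF meas[OF P], symmetric]) (intro continuous_on_compose2[OF g] continuous_intros subset_UNIV)
  finally show ?thesis .
qed

text \<open>The Futaki-Ono invariant evaluates affine functions at the points \<open>p\<close> with \<open>kp\<close> in the lattice;
  rescaling the linear part moves the statement from \<open>P\<close> to \<open>kP\<close>.\<close>

lemma weakly_symmetric_affine_means: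
  fixes P :: "(real^'n) set"
  assumes sym: "weakly_symmetric P" and P: "compact P" and k: "0 < k"
  shows "volume_mean (dilate k P) (affine_fn c b) = lattice_mean (dilate k P) (affine_fn c b)"
proof -
  let ?a = "affine_fn c (real k *\<^sub>R b)" and ?Q = "dilate k P"
  have a: "?a p = affine_fn c b (real k *\<^sub>R p)" for p
    by (simp add: affine_fn_eq)
  have "volume_mean ?Q (affine_fn c b) = volume_mean P ?a"
    unfolding volume_mean_def measure_dilate[OF P] set_integral_dilate[OF k P continuous_on_affine_fn] a using k by simp
  also have "\<dots> = 1 / real (chi ?Q) * (\<Sum>p | real k *\<^sub>R p \<in> ?Q \<inter> lattice. ?a p)"
    using sym k unfolding weakly_symmetric_def futaki_ono_def by (metis eq_iff_diff_eq_0)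
  also have "(\<Sum>p | real k *\<^sub>R p \<in> ?Q \<inter> lattice. ?a p) = (\<Sum>p\<in>?Q \<inter> lattice. affine_fn c b p)"
    using k by (intro sum.reindex_bij_witness[of _ "\<lambda>p. (1 / real k) *\<^sub>R p" "\<lambda>p. real k *\<^sub>R p"]) (auto simp: a)
  finally show ?thesis
    by (simp add: lattice_mean_def)
qed

lemma volume_mean_diff:
  assumes "f absolutely_integrable_on K" "g absolutely_integrable_on K"
  shows "volume_mean K (\<lambda>x. f x - g x) = volume_mean K f - volume_mean K g"
  using assms by (simp add: volume_mean_def set_integral_diff right_diff_distrib)

lemma lattice_mean_diff: "lattice_mean K (\<lambda>x. f x - g x) = lattice_mean K f - lattice_mean K g"
  by (simp add: lattice_mean_def sum_subtractf right_diff_distrib)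

theorem theorem1p4:
  fixes P :: "(real^'n) set"
  assumes "special_polytope P"
  shows "asymptotically_chow_polystable P"
proof -
  have P: "integral_polytope P" "reflexive_polytope P" "weakly_symmetric P" "regular_boundary P"
    using assms by (auto simp: special_polytope_def)
  have "polytope P"
    using P(1) unfolding integral_polytope_def polytope_def by blast
  then have convP: "convex P" and compP: "compact P"
    by (auto intro: polytope_imp_convex polytope_imp_compact)
  have intP: "0 \<in> interior P"
    using P(2) by (simp add: reflexive_polytope_def)
  have "\<forall>j. 0 < j \<longrightarrow> (\<exists>\<B>. boundary_cones j P \<B>)"
    using exists_boundary_cones[OF P(1,2,4)] by blast
  then obtain \<B> where \<B>: "\<And>j. 0 < j \<Longrightarrow> boundary_cones j P (\<B> j)"
    by metis
  obtain C where C: "\<And>k. C \<le> k \<Longrightarrow> real (chi (dilate k P))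
      < real k ^ CARD('n) * measure lebesgue P * (1 + (real CARD('n) + 1) / (2 * real k))"
    using eventually_chi_dilate_less[OF convP compP intP \<B>[OF zero_less_one]]
    unfolding eventually_sequentially by blast
  have main: "volume_mean (dilate k P) f \<le> lattice_mean (dilate k P) f \<and>
      (volume_mean (dilate k P) f = lattice_mean (dilate k P) f \<longrightarrow> (\<exists>c b. \<forall>x\<in>dilate k P. f x = affine_fn c b x))"
    if k: "C + 1 \<le> k" and f: "convex_on (dilate k P) f" for k and f :: "real^'n \<Rightarrow> real"
  proof -
    let ?Q = "dilate k P"
    have k0: "0 < k" "C \<le> k"
      using k by auto
    have Q: "compact ?Q"
      unfolding dilate_def using compP by (rule compact_scaling)
    have "interior ?Q = (\<lambda>x. real k *\<^sub>R x) ` interior P"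
      unfolding dilate_def using k0 by (intro interior_injective_linear_image) (auto simp: linear_scaleR inj_on_def)
    then have intQ: "0 \<in> interior ?Q"
      using intP by (auto intro: rev_image_eqI)
    obtain b where b: "\<And>x. x \<in> ?Q \<Longrightarrow> f 0 + b \<bullet> (x - 0) \<le> f x"
      using convex_on_affine_minorant[OF f intQ] by blast
    \<comment> \<open>Subtracting the support function \<open>?a\<close> changes both means by the same amount.\<close>
    let ?a = "affine_fn (f 0) b"
    let ?g = "\<lambda>x. f x - ?a x"
    have "concave_on ?Q ?a"
      using convex_on_imp_convex[OF f]
      by (auto simp: concave_on_iff affine_fn_eq inner_add_right algebra_simps simp flip: distrib_right)
    then have g_convex: "convex_on ?Q ?g"
      by (rule convex_on_diff[OF f])
    interpret g: normalized_convex P \<B> ?g k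
    proof
      show "0 \<le> ?g x" if "x \<in> ?Q" for x
        using b[OF that] by (simp add: affine_fn_eq)
    qed (use convP compP intP \<B> k0 g_convex in \<open>auto simp: affine_fn_eq\<close>)
    have "(\<lambda>x. ?g x + ?a x) absolutely_integrable_on ?Q"
      by (intro set_integral_add g.f_integrable affine_fn_integrable Q)
    then have f_int: "f absolutely_integrable_on ?Q"
      by simp
    have vm: "volume_mean ?Q ?g = volume_mean ?Q f - volume_mean ?Q ?a"
      by (intro volume_mean_diff f_int affine_fn_integrable Q)
    have lm: "lattice_mean ?Q ?g = lattice_mean ?Q f - lattice_mean ?Q ?a"
      by (rule lattice_mean_diff)
    have affine: "volume_mean ?Q ?a = lattice_mean ?Q ?a"
      by (rule weakly_symmetric_affine_means[OF P(3) compP k0(1)])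
    have "volume_mean ?Q f \<le> lattice_mean ?Q f"
      using g.normalized_chow_inequality(1)[OF C[OF k0(2)]] unfolding vm lm affine by simp
    moreover have "\<forall>x\<in>?Q. f x = ?a x" if "volume_mean ?Q f = lattice_mean ?Q f"
      using g.normalized_chow_inequality(2)[OF C[OF k0(2)]] that unfolding vm lm affine by simp
    ultimately show ?thesis
      by blast
  qed
  show ?thesis
    unfolding asymptotically_chow_polystable_def chow_semistable_from_def
    using main by (intro exI[of _ "C + 1"]) auto
qed

end
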